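(* Let $K$ be a field, $E$ a finite graph, and $\sigma$ an automorphism of $E$, with induced graded automorphism of the Leavitt path algebra $L_K(E)$ also denoted $\sigma$. Then $L_K(E)$ has Unbounded Generating Number if and only if $L_K(E)^{\sigma}$ has Unbounded Generating Number.
   Context: A graph $E=(E^0,E^1,s,r)$ consists of disjoint sets $E^0$ (vertices) and $E^1$ (edges) and maps $s,r\colon E^1\to E^0$; it is finite if both sets are finite. A regular vertex is $v$ with $0<|s^{-1}(v)|<\infty$. An automorphism of $E$ is a pair $\sigma=(\sigma_0,\sigma_1)$ of bijections of $E^0$ and $E^1$ with $s\circ\sigma_1=\sigma_0\circ s$, $r\circ\sigma_1=\sigma_0\circ r$. The Leavitt path algebra $L_K(E)$ is the $K$-algebra generated by $E^0\cup E^1\cup\{e^*\mid e\in E^1\}$ subject to: (1) $vw=\delta_{v,w}w$; (2) $s(e)e=e=er(e)$, $e^*s(e)=e^*=r(e)e^*$; (3) $e^*f=\delta_{e,f}r(e)$; (4) $v=\sum_{e\in s^{-1}(v)}ee^*$ for every regular vertex $v$; it is $\mathbb Z$-graded by $\deg v=0$, $\deg e=1$, $\deg e^*=-1$. The graph automorphism induces the graded automorphism $v\mapsto\sigma_0(v)$, $e\mapsto\sigma_1(e)$, $e^*\mapsto\sigma_1(e)^*$ of $L_K(E)$. The Zhang twist $L_K(E)^\sigma$ has the same underlying graded space and multiplication $a\star b=a\,\sigma^m(b)$ for $a$ homogeneous of degree $m$. A unital ring $R$ has Unbounded Generating Number (UGN) if, for each positive integer $m$, any set of generators of the free right $R$-module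 $R^m$ has cardinality $\ge m$; equivalently, if the existence of an epimorphism of right $R$-modules $R^n\to R^m$ implies $n\ge m$. *)

theory Defs
  imports
    "HOL-Library.Poly_Mapping"
    "Graph_Theory.Digraph"
    "HOL-Algebra.QuotRing"
    "HOL-Algebra.Module"
begin

section \<open>Graph automorphisms\<close>

text \<open>
  Graphs are taken from \<^theory>\<open>Graph_Theory.Digraph\<close>: \<^const>\<open>verts\<close>, \<^const>\<open>arcs\<close>,
  \<^const>\<open>tail\<close> and \<^const>\<open>head\<close> are $E^0$, $E^1$, $s$ and $r$.  Loops and parallel edges are
  allowed; \<^locale>\<open>fin_digraph\<close> says that both sets are finite and that $s, r$ map
  $E^1$ into $E^0$.  The two functions of an automorphism matter only on
  \<^const>\<open>verts\<close> and \<^const>\<open>arcs\<close>.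
\<close>

definition graph_automorphism ::
    "('v, 'e) pre_digraph \<Rightarrow> ('v \<Rightarrow> 'v) \<times> ('e \<Rightarrow> 'e) \<Rightarrow> bool" where
  "graph_automorphism E \<sigma> \<longleftrightarrow>
     bij_betw (fst \<sigma>) (verts E) (verts E) \<and>
     bij_betw (snd \<sigma>) (arcs E) (arcs E) \<and>
     (\<forall>e\<in>arcs E. tail E (snd \<sigma> e) = fst \<sigma> (tail E e) \<and>
                   head E (snd \<sigma> e) = fst \<sigma> (head E e))"

definition regular_vertex :: "('v, 'e) pre_digraph \<Rightarrow> 'v \<Rightarrow> bool" where
  "regular_vertex E v \<longleftrightarrow> v \<in> verts E \<and> out_arcs E v \<noteq> {} \<and> finite (out_arcs E v)"


section \<open>Leavitt path algebras\<close>

text \<open>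
  With lists as the free monoid under concatenation, \<^typ>\<open>'x list \<Rightarrow>\<^sub>0 'k\<close> with its
  convolution product is the free unital algebra over \<^typ>\<open>'k\<close> on the letters \<^typ>\<open>'x\<close>.
\<close>

instantiation list :: (type) monoid_add
begin
definition zero_list :: "'a list" where "zero_list = []"
definition plus_list :: "'a list \<Rightarrow> 'a list \<Rightarrow> 'a list" where "plus_list = (@)"
instance by standard (simp_all add: zero_list_def plus_list_def)
end

datatype ('v, 'e) lpa_gen = Vertex 'v | Edge 'e | Ghost 'e

type_synonym ('v, 'e, 'k) path_poly = "('v, 'e) lpa_gen list \<Rightarrow>\<^sub>0 'k"

definition gen :: "('v, 'e) lpa_gen \<Rightarrow> ('v, 'e, 'k::field) path_poly" where
  "gen x = Poly_Mapping.single [x] 1"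

definition generators :: "('v, 'e) pre_digraph \<Rightarrow> ('v, 'e) lpa_gen set" where
  "generators E = Vertex ` verts E \<union> Edge ` arcs E \<union> Ghost ` arcs E"

text \<open>
  The algebra generated by $E^0 \cup E^1 \cup (E^1)^*$ is not assumed to be unital, so
  it is a quotient of the free algebra without unit, which is spanned by the nonempty words.
\<close>

definition free_carrier :: "('v, 'e) pre_digraph \<Rightarrow> ('v, 'e, 'k::field) path_poly set" where
  "free_carrier E = {x. \<forall>w\<in>Poly_Mapping.keys x. w \<noteq> [] \<and> set w \<subseteq> generators E}"

inductive_set leavitt_relations ::
    "('v, 'e) pre_digraph \<Rightarrow> ('v, 'e, 'k::field) path_poly set"
  for E :: "('v, 'e) pre_digraph" where
  vertices: "\<lbrakk>v \<in> verts E; w \<in> verts E\<rbrakk> \<Longrightarrow>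
    gen (Vertex v) * gen (Vertex w) - (if v = w then gen (Vertex w) else 0)
      \<in> leavitt_relations E"
| edge_source: "e \<in> arcs E \<Longrightarrow>
    gen (Vertex (tail E e)) * gen (Edge e) - gen (Edge e) \<in> leavitt_relations E"
| edge_range: "e \<in> arcs E \<Longrightarrow>
    gen (Edge e) * gen (Vertex (head E e)) - gen (Edge e) \<in> leavitt_relations E"
| ghost_source: "e \<in> arcs E \<Longrightarrow>
    gen (Ghost e) * gen (Vertex (tail E e)) - gen (Ghost e) \<in> leavitt_relations E"
| ghost_range: "e \<in> arcs E \<Longrightarrow>
    gen (Vertex (head E e)) * gen (Ghost e) - gen (Ghost e) \<in> leavitt_relations E"
| ghost_edge: "\<lbrakk>e \<in> arcs E; f \<in> arcs E\<rbrakk> \<Longrightarrow>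
    gen (Ghost e) * gen (Edge f) - (if e = f then gen (Vertex (head E e)) else 0)
      \<in> leavitt_relations E"
| regular: "regular_vertex E v \<Longrightarrow>
    gen (Vertex v) - (\<Sum>e\<in>out_arcs E v. gen (Edge e) * gen (Ghost e))
      \<in> leavitt_relations E"

text \<open>
  The two-sided algebra ideal of the free algebra without unit generated by the relations.
  The library's \<^const>\<open>genideal\<close> presupposes a unital ring and does not apply.
\<close>

inductive_set leavitt_ideal ::
    "('v, 'e) pre_digraph \<Rightarrow> ('v, 'e, 'k::field) path_poly set"
  for E :: "('v, 'e) pre_digraph" where
  relation: "x \<in> leavitt_relations E \<Longrightarrow> x \<in> leavitt_ideal E"
| zero: "0 \<in> leavitt_ideal E"
| add: "\<lbrakk>x \<in> leavitt_ideal E; y \<in> leavitt_ideal E\<rbrakk> \<Longrightarrow> x + y \<in> leavitt_ideal E"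
| scale: "x \<in> leavitt_ideal E \<Longrightarrow> Poly_Mapping.map ((*) c) x \<in> leavitt_ideal E"
| mult_left: "\<lbrakk>x \<in> leavitt_ideal E; a \<in> free_carrier E\<rbrakk> \<Longrightarrow> a * x \<in> leavitt_ideal E"
| mult_right: "\<lbrakk>x \<in> leavitt_ideal E; a \<in> free_carrier E\<rbrakk> \<Longrightarrow> x * a \<in> leavitt_ideal E"

text \<open>
  The element in the field \<^const>\<open>one\<close> is not neutral in the free algebra without unit;
  its class is the unit of the quotient when $E^0$ is finite.
\<close>

definition free_path_algebra ::
    "'k::field itself \<Rightarrow> ('v, 'e) pre_digraph \<Rightarrow> ('v, 'e, 'k) path_poly ring" where
  "free_path_algebra K E =
     \<lparr>carrier = free_carrier E, mult = (*), one = (\<Sum>v\<in>verts E. gen (Vertex v)),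
      zero = 0, add = (+)\<rparr>"

definition leavitt_path_algebra ::
    "'k::field itself \<Rightarrow> ('v, 'e) pre_digraph \<Rightarrow> ('v, 'e, 'k) path_poly set ring" where
  "leavitt_path_algebra K E = free_path_algebra K E Quot leavitt_ideal E"


section \<open>The grading and the induced automorphism\<close>

fun gen_degree :: "('v, 'e) lpa_gen \<Rightarrow> int" where
  "gen_degree (Vertex v) = 0"
| "gen_degree (Edge e) = 1"
| "gen_degree (Ghost e) = -1"

definition word_degree :: "('v, 'e) lpa_gen list \<Rightarrow> int" where
  "word_degree w = sum_list (map gen_degree w)"

definition leavitt_grading ::
    "'k::field itself \<Rightarrow> ('v, 'e) pre_digraph \<Rightarrow> int \<Rightarrow> ('v, 'e, 'k) path_poly set set" where
  "leavitt_grading K E m =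
     (\<lambda>x. leavitt_ideal E +>\<^bsub>free_path_algebra K E\<^esub> x) `
       {x \<in> free_carrier E. \<forall>w\<in>Poly_Mapping.keys x. word_degree w = m}"

fun gen_map :: "('v \<Rightarrow> 'v) \<times> ('e \<Rightarrow> 'e) \<Rightarrow> ('v, 'e) lpa_gen \<Rightarrow> ('v, 'e) lpa_gen" where
  "gen_map \<sigma> (Vertex v) = Vertex (fst \<sigma> v)"
| "gen_map \<sigma> (Edge e) = Edge (snd \<sigma> e)"
| "gen_map \<sigma> (Ghost e) = Ghost (snd \<sigma> e)"

definition free_map ::
    "('v \<Rightarrow> 'v) \<times> ('e \<Rightarrow> 'e) \<Rightarrow> ('v, 'e, 'k::field) path_poly \<Rightarrow> ('v, 'e, 'k) path_poly" where
  "free_map \<sigma> x =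
     (\<Sum>w\<in>Poly_Mapping.keys x. Poly_Mapping.single (map (gen_map \<sigma>) w) (Poly_Mapping.lookup x w))"

text \<open>
  Elements of the Leavitt path algebra are cosets.  A graph automorphism permutes the
  defining relations, so \<^term>\<open>free_map \<sigma>\<close> maps the ideal onto itself and the image of
  the coset of \<open>x\<close> is the coset of \<^term>\<open>free_map \<sigma> x\<close>.
\<close>

definition leavitt_automorphism ::
    "'k::field itself \<Rightarrow> ('v \<Rightarrow> 'v) \<times> ('e \<Rightarrow> 'e) \<Rightarrow>
       ('v, 'e, 'k) path_poly set \<Rightarrow> ('v, 'e, 'k) path_poly set" where
  "leavitt_automorphism K \<sigma> X = free_map \<sigma> ` X"


section \<open>Zhang twists\<close>

text \<open>
  \<open>A m\<close> is the subgroup of homogeneous elements of degree \<open>m\<close> of a graded ring \<open>R\<close>.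
  The family of homogeneous parts is well defined because \<open>R\<close> is the direct sum of the
  \<open>A m\<close>.
\<close>

definition homogeneous_parts ::
    "('a, 'm) ring_scheme \<Rightarrow> (int \<Rightarrow> 'a set) \<Rightarrow> 'a \<Rightarrow> int \<Rightarrow> 'a" where
  "homogeneous_parts R A a =
     (THE c. (\<forall>m. c m \<in> A m) \<and> finite {m. c m \<noteq> \<zero>\<^bsub>R\<^esub>} \<and>
             a = (\<Oplus>\<^bsub>R\<^esub>m\<in>{m. c m \<noteq> \<zero>\<^bsub>R\<^esub>}. c m))"

definition automorphism_power ::
    "('a, 'm) ring_scheme \<Rightarrow> ('a \<Rightarrow> 'a) \<Rightarrow> int \<Rightarrow> 'a \<Rightarrow> 'a" where
  "automorphism_power R \<sigma> m =
     (if m \<ge> 0 then \<sigma> ^^ nat m else inv_into (carrier R) \<sigma> ^^ nat (- m))"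

text \<open>The additive extension of $a \star b = a\,\sigma^m(b)$ for \<open>a\<close> homogeneous of degree \<open>m\<close>.\<close>

definition zhang_twist :: "'a ring \<Rightarrow> (int \<Rightarrow> 'a set) \<Rightarrow> ('a \<Rightarrow> 'a) \<Rightarrow> 'a ring" where
  "zhang_twist R A \<sigma> = R\<lparr>mult := \<lambda>a b.
     (\<Oplus>\<^bsub>R\<^esub>m\<in>{m. homogeneous_parts R A a m \<noteq> \<zero>\<^bsub>R\<^esub>}.
        homogeneous_parts R A a m \<otimes>\<^bsub>R\<^esub> automorphism_power R \<sigma> m b)\<rparr>"

definition leavitt_zhang_twist ::
    "'k::field itself \<Rightarrow> ('v, 'e) pre_digraph \<Rightarrow> ('v \<Rightarrow> 'v) \<times> ('e \<Rightarrow> 'e) \<Rightarrow>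
       ('v, 'e, 'k) path_poly set ring" where
  "leavitt_zhang_twist K E \<sigma> =
     zhang_twist (leavitt_path_algebra K E) (leavitt_grading K E) (leavitt_automorphism K \<sigma>)"


section \<open>Unbounded Generating Number\<close>

text \<open>
  The free right module $R^m$.  The library's \<^locale>\<open>module\<close> is restricted to commutative
  rings, but its record type and \<^locale>\<open>submodule\<close> are not; \<open>a \<odot> x\<close> stands for the
  right action $x \cdot a$.  The fields \<^const>\<open>mult\<close> and \<^const>\<open>one\<close> of a module record
  have no meaning.
\<close>

definition free_right_module :: "('a, 'm) ring_scheme \<Rightarrow> nat \<Rightarrow> ('a, nat \<Rightarrow> 'a) module" where
  "free_right_module R m =
     \<lparr>carrier = {..<m} \<rightarrow>\<^sub>E carrier R, mult = undefined, one = undefined,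
      zero = (\<lambda>i\<in>{..<m}. \<zero>\<^bsub>R\<^esub>), add = (\<lambda>x y. \<lambda>i\<in>{..<m}. x i \<oplus>\<^bsub>R\<^esub> y i),
      smult = (\<lambda>a x. \<lambda>i\<in>{..<m}. x i \<otimes>\<^bsub>R\<^esub> a)\<rparr>"

definition module_generated_by ::
    "('a, 'm) ring_scheme \<Rightarrow> ('a, 'b, 'n) module_scheme \<Rightarrow> 'b set \<Rightarrow> bool" where
  "module_generated_by R M S \<longleftrightarrow>
     S \<subseteq> carrier M \<and> \<Inter>{H. submodule H R M \<and> S \<subseteq> H} = carrier M"

definition unbounded_generating_number :: "('a, 'm) ring_scheme \<Rightarrow> bool" where
  "unbounded_generating_number R \<longleftrightarrow>
     (\<forall>m>0. \<forall>S. module_generated_by R (free_right_module R m) S \<longrightarrow>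
        infinite S \<or> m \<le> card S)"

end

theory Submission
  imports Defs "HOL-Combinatorics.Cycles"
begin

text \<open>
  Let $L$ be the Leavitt path algebra and $\sigma$ the automorphism induced by the graph
  automorphism.  Over a unital ring $R$, an epimorphism $R^n \to R^m$ splits because $R^m$ is free,
  so $R$ has unbounded generating number iff a factorisation $XY = 1_m$ through $R^n$ forces
  $m \le n$ (\<open>unbounded_generating_number_iff\<close>).  Consequently, if there is a unital
  homomorphism $R \to M_N(S)$ with $N > 0$ and $S$ has unbounded generating number, then so
  does $R$: replacing each entry of $X$ and $Y$ by its $N \times N$ block factors $1_{mN}$
  through $S^{nN}$ (\<open>unbounded_generating_number_along_matrix_hom\<close>).

  The graph is finite, so $\sigma$ permutes finitely many generators and $\sigma^N = 1$ for
  some $N > 0$.  Let $P$ be the $N \times N$ matrix of the cyclic shift.  For $a$ homogeneous of degree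
  $m$ put $\rho(a) = \mathrm{diag}(a, \sigma(a), \dots, \sigma^{N-1}(a))\, P^m$.
  Moving $P^m$ past a diagonal matrix of this kind applies $\sigma^m$ to its entries,
  hence $\rho(a)\rho(b) = \rho(a\,\sigma^m(b))$ over $L$, that is, $\rho$ is a unital
  homomorphism $L^\sigma \to M_N(L)$.  As $L$ is in turn the twist of $L^\sigma$ by $\sigma^{-1}$, the same
  formula with $\sigma^{-1}$ gives $L \to M_N(L^\sigma)$.  Both directions of the
  equivalence follow from these two homomorphisms.

  To treat both at once, all twists $L^{\sigma^c}$ are considered, with
  $\rho_{ij}(a) = \sigma^{(c-c')i}(a)$ for $a$ of degree congruent to $j - i$ as a homomorphism
  from $L^{\sigma^c}$ to matrices over $L^{\sigma^{c'}}$ (\<open>block_mult\<close>).  The calculations are made with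
  representatives in the free algebra, where a bilinear identity needs to be checked on words only.
\<close>


section \<open>Unbounded generating number and factorisations of identity matrices\<close>

text \<open>
  The matrix \<open>X\<close> describes an epimorphism $R^n \to R^m$ of right modules and \<open>Y\<close> a section of it.
\<close>

definition identity_factors :: "('a, 'm) ring_scheme \<Rightarrow> nat \<Rightarrow> nat \<Rightarrow> bool" where
  "identity_factors R m n \<longleftrightarrow>
     (\<exists>X Y. (\<forall>i<m. \<forall>j<n. X i j \<in> carrier R \<and> Y j i \<in> carrier R) \<and>
       (\<forall>i<m. \<forall>k<m. (\<Oplus>\<^bsub>R\<^esub>j\<in>{..<n}. X i j \<otimes>\<^bsub>R\<^esub> Y j k) =
          (if i = k then \<one>\<^bsub>R\<^esub> else \<zero>\<^bsub>R\<^esub>)))"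

text \<open>
  This is the product of the matrix \<open>X\<close> with the column \<open>a\<close>, in the extensional form in which
  elements of \<^const>\<open>free_right_module\<close> are functions on \<open>{..<m}\<close>.
\<close>

definition column_combination ::
    "('a, 'm) ring_scheme \<Rightarrow> nat \<Rightarrow> nat \<Rightarrow> (nat \<Rightarrow> nat \<Rightarrow> 'a) \<Rightarrow> (nat \<Rightarrow> 'a) \<Rightarrow> nat \<Rightarrow> 'a" where
  "column_combination R m n X a = (\<lambda>i\<in>{..<m}. \<Oplus>\<^bsub>R\<^esub>j\<in>{..<n}. X i j \<otimes>\<^bsub>R\<^esub> a j)"

context ring
begin

lemma free_right_module_group: "group (add_monoid (free_right_module R m))"
proof (rule groupI)
  fix x assume x: "x \<in> carrier (add_monoid (free_right_module R m))"
  have "(\<lambda>i\<in>{..<m}. \<ominus> x i) \<in> carrier (add_monoid (free_right_module R m))"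
    "(\<lambda>i\<in>{..<m}. \<ominus> x i) \<otimes>\<^bsub>add_monoid (free_right_module R m)\<^esub> x = \<one>\<^bsub>add_monoid (free_right_module R m)\<^esub>"
    using x by (auto simp: free_right_module_def PiE_iff fun_eq_iff l_neg)
  then show "\<exists>y\<in>carrier (add_monoid (free_right_module R m)).
      y \<otimes>\<^bsub>add_monoid (free_right_module R m)\<^esub> x = \<one>\<^bsub>add_monoid (free_right_module R m)\<^esub>"
    by blast
qed (auto simp: free_right_module_def PiE_iff fun_eq_iff a_assoc extensional_def restrict_def)

text \<open>
  Closure under additive inverses follows from the action of $-1$.
\<close>

lemma submodule_free_right_moduleI:
  fixes m :: nat
  assumes "H \<subseteq> {..<m} \<rightarrow>\<^sub>E carrier R"
    and "(\<lambda>i\<in>{..<m}. \<zero>) \<in> H"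
    and "\<And>x y. \<lbrakk>x \<in> H; y \<in> H\<rbrakk> \<Longrightarrow> (\<lambda>i\<in>{..<m}. x i \<oplus> y i) \<in> H"
    and smult: "\<And>a x. \<lbrakk>a \<in> carrier R; x \<in> H\<rbrakk> \<Longrightarrow> (\<lambda>i\<in>{..<m}. x i \<otimes> a) \<in> H"
  shows "submodule H R (free_right_module R m)"
proof -
  interpret M: group "add_monoid (free_right_module R m)"
    by (rule free_right_module_group)
  have inv: "inv\<^bsub>add_monoid (free_right_module R m)\<^esub> x \<in> H" if x: "x \<in> H" for x
  proof -
    have xi: "x \<in> {..<m} \<rightarrow>\<^sub>E carrier R"
      using assms(1) x by blast
    have "(\<lambda>i\<in>{..<m}. x i \<otimes> (\<ominus> \<one>)) \<in> H"
      using smult[OF _ x] by simp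
    moreover have "(\<lambda>i\<in>{..<m}. x i \<otimes> (\<ominus> \<one>)) = (\<lambda>i\<in>{..<m}. \<ominus> x i)"
      using xi by (auto simp: fun_eq_iff PiE_iff r_minus)
    moreover have "inv\<^bsub>add_monoid (free_right_module R m)\<^esub> x = (\<lambda>i\<in>{..<m}. \<ominus> x i)"
      by (rule M.inv_equality) (use xi in \<open>auto simp: free_right_module_def PiE_iff fun_eq_iff l_neg\<close>)
    ultimately show ?thesis
      by simp
  qed
  have M: "\<zero>\<^bsub>free_right_module R m\<^esub> = (\<lambda>i\<in>{..<m}. \<zero>)"
    "carrier (free_right_module R m) = {..<m} \<rightarrow>\<^sub>E carrier R"
    "x \<oplus>\<^bsub>free_right_module R m\<^esub> y = (\<lambda>i\<in>{..<m}. x i \<oplus> y i)"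
    "a \<odot>\<^bsub>free_right_module R m\<^esub> x = (\<lambda>i\<in>{..<m}. x i \<otimes> a)" for x y a
    by (simp_all add: free_right_module_def)
  show ?thesis
    unfolding submodule_def submodule_axioms_def subgroup_def
    using assms inv by (simp add: M)
qed

lemma column_combination_in_submodule:
  fixes m n :: nat
  assumes H: "submodule H R (free_right_module R m)"
    and X: "\<And>i j. \<lbrakk>i < m; j < n\<rbrakk> \<Longrightarrow> X i j \<in> carrier R"
    and cols: "\<And>j. j < n \<Longrightarrow> (\<lambda>i\<in>{..<m}. X i j) \<in> H"
    and a: "\<And>j. j < n \<Longrightarrow> a j \<in> carrier R"
  shows "column_combination R m n X a \<in> H"
  using X cols a
proof (induction n)
  case 0
  interpret H: submodule H R "free_right_module R m" by fact
  show ?case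
    using H.one_closed by (simp add: column_combination_def free_right_module_def restrict_def)
next
  case (Suc n)
  interpret H: submodule H R "free_right_module R m" by fact
  have c: "column_combination R m n X a \<in> H"
    using Suc by simp
  have "a n \<odot>\<^bsub>free_right_module R m\<^esub> (\<lambda>i\<in>{..<m}. X i n) \<in> H"
    by (intro H.smult_closed Suc.prems) simp_all
  then have "(\<lambda>i\<in>{..<m}. X i n \<otimes> a n) \<in> H"
    by (simp add: free_right_module_def cong: restrict_cong)
  from H.m_closed[OF this c]
  have "(\<lambda>i\<in>{..<m}. X i n \<otimes> a n \<oplus> (\<Oplus>j\<in>{..<n}. X i j \<otimes> a j)) \<in> H"
    by (simp add: free_right_module_def column_combination_def cong: restrict_cong)
  also have "(\<lambda>i\<in>{..<m}. X i n \<otimes> a n \<oplus> (\<Oplus>j\<in>{..<n}. X i j \<otimes> a j)) = column_combination R m (Suc n) X a"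
    unfolding column_combination_def lessThan_Suc
    using Suc.prems by (intro restrict_ext) (subst finsum_insert, auto)
  finally show ?case .
qed

lemma finsum_delta_left:
  assumes "finite A" "k \<in> A" "\<And>j. j \<in> A \<Longrightarrow> x j \<in> carrier R"
  shows "(\<Oplus>j\<in>A. x j \<otimes> (if j = k then \<one> else \<zero>)) = x k"
proof -
  have "(\<Oplus>j\<in>A. x j \<otimes> (if j = k then \<one> else \<zero>)) = (\<Oplus>j\<in>A. if k = j then x j else \<zero>)"
    using assms by (intro finsum_cong') auto
  also have "\<dots> = x k"
    using assms by (intro finsum_singleton) auto
  finally show ?thesis .
qed

lemma finsum_delta_right:
  assumes "finite A" "k \<in> A" "\<And>j. j \<in> A \<Longrightarrow> x j \<in> carrier R"
  shows "(\<Oplus>j\<in>A. (if k = j then \<one> else \<zero>) \<otimes> x j) = x k"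
proof -
  have "(\<Oplus>j\<in>A. (if k = j then \<one> else \<zero>) \<otimes> x j) = (\<Oplus>j\<in>A. if k = j then x j else \<zero>)"
    using assms by (intro finsum_cong') auto
  also have "\<dots> = x k"
    using assms by (intro finsum_singleton) auto
  finally show ?thesis .
qed

text \<open>
  A submodule that contains the columns of \<open>X\<close> contains the columns of $XY = 1$, which are the
  standard basis.
\<close>

lemma columns_generate:
  fixes m n :: nat
  assumes X: "\<And>i j. \<lbrakk>i < m; j < n\<rbrakk> \<Longrightarrow> X i j \<in> carrier R"
    and Y: "\<And>j k. \<lbrakk>j < n; k < m\<rbrakk> \<Longrightarrow> Y j k \<in> carrier R"
    and XY: "\<And>i k. \<lbrakk>i < m; k < m\<rbrakk> \<Longrightarrow>
      (\<Oplus>j\<in>{..<n}. X i j \<otimes> Y j k) = (if i = k then \<one> else \<zero>)"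
  shows "module_generated_by R (free_right_module R m) ((\<lambda>j. \<lambda>i\<in>{..<m}. X i j) ` {..<n})"
    (is "module_generated_by R ?M ?S")
  unfolding module_generated_by_def
proof
  show S: "?S \<subseteq> carrier ?M"
    using X by (auto simp: free_right_module_def split: if_splits)
  have gen: "carrier ?M \<subseteq> H" if H: "submodule H R ?M" and S: "?S \<subseteq> H" for H
  proof
    fix z assume "z \<in> carrier ?M"
    then have z: "z \<in> {..<m} \<rightarrow>\<^sub>E carrier R"
      by (simp add: free_right_module_def)
    have e: "(\<lambda>i\<in>{..<m}. if i = k then \<one> else \<zero>) \<in> H" if k: "k < m" for k
    proof -
      have "column_combination R m n X (\<lambda>j. Y j k) \<in> H"
        by (rule column_combination_in_submodule[OF H X]) (use S Y k in auto)
      then show ?thesis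
        using XY k by (simp add: column_combination_def cong: restrict_cong)
    qed
    have "column_combination R m m (\<lambda>i k. if i = k then \<one> else \<zero>) z \<in> H"
      by (rule column_combination_in_submodule[OF H]) (use e z in auto)
    moreover have "column_combination R m m (\<lambda>i k. if i = k then \<one> else \<zero>) z = z"
      unfolding column_combination_def
    proof
      fix i
      show "(\<lambda>i\<in>{..<m}. \<Oplus>k\<in>{..<m}. (if i = k then \<one> else \<zero>) \<otimes> z k) i = z i"
        using z by (cases "i < m") (auto simp: PiE_iff extensional_def intro!: finsum_delta_right)
    qed
    ultimately show "z \<in> H"
      by simp
  qed
  have "submodule (carrier ?M) R ?M"
    by (rule submodule_free_right_moduleI) (auto simp: free_right_module_def PiE_iff)
  with S gen show "\<Inter>{H. submodule H R ?M \<and> ?S \<subseteq> H} = carrier ?M"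
    by blast
qed

lemma span_submodule:
  fixes m n :: nat
  assumes X: "\<And>i j. \<lbrakk>i < m; j < n\<rbrakk> \<Longrightarrow> X i j \<in> carrier R"
  shows "submodule (column_combination R m n X ` {a. \<forall>j<n. a j \<in> carrier R}) R (free_right_module R m)"
proof (rule submodule_free_right_moduleI)
  let ?H = "column_combination R m n X ` {a. \<forall>j<n. a j \<in> carrier R}"
  show "?H \<subseteq> {..<m} \<rightarrow>\<^sub>E carrier R"
    using X by (auto simp: column_combination_def intro!: finsum_closed split: if_splits)
  have "column_combination R m n X (\<lambda>j. \<zero>) = (\<lambda>i\<in>{..<m}. \<zero>)"
    unfolding column_combination_def
    by (intro restrict_ext add.finprod_one_eqI) (use X in auto)
  then show "(\<lambda>i\<in>{..<m}. \<zero>) \<in> ?H"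
    by (intro image_eqI[of _ _ "\<lambda>j. \<zero>"]) auto
  show "(\<lambda>i\<in>{..<m}. x i \<oplus> y i) \<in> ?H" if x: "x \<in> ?H" and y: "y \<in> ?H" for x y
  proof -
    obtain a b where a: "\<forall>j<n. a j \<in> carrier R" "x = column_combination R m n X a"
      and b: "\<forall>j<n. b j \<in> carrier R" "y = column_combination R m n X b"
      using x y by auto
    have "(\<lambda>i\<in>{..<m}. x i \<oplus> y i) = column_combination R m n X (\<lambda>j. a j \<oplus> b j)"
      unfolding column_combination_def a b
    proof (intro restrict_ext)
      fix i assume i: "i \<in> {..<m}"
      have "(\<Oplus>j\<in>{..<n}. X i j \<otimes> (a j \<oplus> b j)) = (\<Oplus>j\<in>{..<n}. X i j \<otimes> a j \<oplus> X i j \<otimes> b j)"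
        using X a b i by (intro finsum_cong') (auto simp: r_distr)
      also have "\<dots> = (\<Oplus>j\<in>{..<n}. X i j \<otimes> a j) \<oplus> (\<Oplus>j\<in>{..<n}. X i j \<otimes> b j)"
        using X a b i by (intro finsum_addf) auto
      finally show "(\<lambda>i\<in>{..<m}. \<Oplus>j\<in>{..<n}. X i j \<otimes> a j) i \<oplus> (\<lambda>i\<in>{..<m}. \<Oplus>j\<in>{..<n}. X i j \<otimes> b j) i
          = (\<Oplus>j\<in>{..<n}. X i j \<otimes> (a j \<oplus> b j))"
        using i by simp
    qed
    then show ?thesis
      using a b by (intro image_eqI[of _ _ "\<lambda>j. a j \<oplus> b j"]) auto
  qed
  show "(\<lambda>i\<in>{..<m}. x i \<otimes> r) \<in> ?H" if r: "r \<in> carrier R" and x: "x \<in> ?H" for r x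
  proof -
    obtain a where a: "\<forall>j<n. a j \<in> carrier R" "x = column_combination R m n X a"
      using x by auto
    have "(\<lambda>i\<in>{..<m}. x i \<otimes> r) = column_combination R m n X (\<lambda>j. a j \<otimes> r)"
      unfolding column_combination_def a
    proof (intro restrict_ext)
      fix i assume i: "i \<in> {..<m}"
      have "(\<Oplus>j\<in>{..<n}. X i j \<otimes> a j) \<otimes> r = (\<Oplus>j\<in>{..<n}. X i j \<otimes> a j \<otimes> r)"
        using X a r i by (intro finsum_ldistr) auto
      also have "\<dots> = (\<Oplus>j\<in>{..<n}. X i j \<otimes> (a j \<otimes> r))"
        using X a r i by (intro finsum_cong') (auto simp: m_assoc)
      finally show "(\<lambda>i\<in>{..<m}. \<Oplus>j\<in>{..<n}. X i j \<otimes> a j) i \<otimes> r = (\<Oplus>j\<in>{..<n}. X i j \<otimes> (a j \<otimes> r))"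
        using i by simp
    qed
    then show ?thesis
      using a r by (intro image_eqI[of _ _ "\<lambda>j. a j \<otimes> r"]) auto
  qed
qed

text \<open>
  Let the generators be the columns of \<open>X\<close>.  Their span is a submodule, so it contains each standard
  basis vector, and the coefficients of the \<open>k\<close>-th one are the \<open>k\<close>-th column of \<open>Y\<close>.
\<close>

lemma generators_give_factorisation:
  assumes S: "module_generated_by R (free_right_module R m) S" and fin: "finite S"
  shows "identity_factors R m (card S)"
proof -
  let ?n = "card S"
  obtain s where s: "bij_betw s {0..<?n} S"
    using ex_bij_betw_nat_finite[OF fin] by blast
  define X where "X i j = s j i" for i j
  have sS: "s j \<in> S" if "j < ?n" for j
    using s that by (auto simp: bij_betw_def)
  have sc: "s j \<in> {..<m} \<rightarrow>\<^sub>E carrier R" if "j < ?n" for j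
    using S sS[OF that] by (auto simp: module_generated_by_def free_right_module_def)
  have X: "X i j \<in> carrier R" if "i < m" "j < ?n" for i j
    using sc[OF that(2)] that by (auto simp: X_def)
  let ?H = "column_combination R m ?n X ` {a. \<forall>j<?n. a j \<in> carrier R}"
  have "x \<in> ?H" if x: "x \<in> S" for x
  proof -
    obtain k where k: "k < ?n" "x = s k"
      using x bij_betw_imp_surj_on[OF s] by (metis atLeastLessThan_iff imageE)
    have "column_combination R m ?n X (\<lambda>j. if j = k then \<one> else \<zero>) = x"
      unfolding column_combination_def
    proof
      fix i
      show "(\<lambda>i\<in>{..<m}. \<Oplus>j\<in>{..<?n}. X i j \<otimes> (if j = k then \<one> else \<zero>)) i = x i"
        using k X sc[OF k(1)]
        by (cases "i < m")
          (auto simp: X_def[symmetric] PiE_iff extensional_def intro!: finsum_delta_left)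
    qed
    then show ?thesis
      by (intro image_eqI[of _ _ "\<lambda>j. if j = k then \<one> else \<zero>"]) auto
  qed
  then have "carrier (free_right_module R m) \<subseteq> ?H"
    using S span_submodule[of m ?n X, OF X] unfolding module_generated_by_def by blast
  moreover have "(\<lambda>i\<in>{..<m}. if i = k then \<one> else \<zero>) \<in> carrier (free_right_module R m)" for k
    by (auto simp: free_right_module_def)
  ultimately have "\<exists>a. (\<forall>j<?n. a j \<in> carrier R) \<and>
      (\<lambda>i\<in>{..<m}. if i = k then \<one> else \<zero>) = column_combination R m ?n X a" for k
    by blast
  then obtain Y where Y: "\<And>j k. j < ?n \<Longrightarrow> Y k j \<in> carrier R"
      "\<And>k. (\<lambda>i\<in>{..<m}. if i = k then \<one> else \<zero>) = column_combination R m ?n X (Y k)"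
    by metis
  have "(\<Oplus>j\<in>{..<?n}. X i j \<otimes> Y k j) = (if i = k then \<one> else \<zero>)" if "i < m" for i k
    using fun_cong[OF Y(2)[of k], of i] that by (simp add: column_combination_def)
  then show ?thesis
    unfolding identity_factors_def using X Y
    by (intro exI[of _ X] exI[of _ "\<lambda>j k. Y k j"]) auto
qed

theorem unbounded_generating_number_iff:
  "unbounded_generating_number R \<longleftrightarrow> (\<forall>m n. identity_factors R m n \<longrightarrow> m \<le> n)"
proof
  assume U: "unbounded_generating_number R"
  show "\<forall>m n. identity_factors R m n \<longrightarrow> m \<le> n"
  proof (intro allI impI)
    fix m n assume "identity_factors R m n"
    then obtain X Y where XY: "\<And>i j. \<lbrakk>i < m; j < n\<rbrakk> \<Longrightarrow> X i j \<in> carrier R"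
      "\<And>j k. \<lbrakk>j < n; k < m\<rbrakk> \<Longrightarrow> Y j k \<in> carrier R"
      "\<And>i k. \<lbrakk>i < m; k < m\<rbrakk> \<Longrightarrow>
        (\<Oplus>j\<in>{..<n}. X i j \<otimes> Y j k) = (if i = k then \<one> else \<zero>)"
      unfolding identity_factors_def by blast
    let ?S = "(\<lambda>j. \<lambda>i\<in>{..<m}. X i j) ` {..<n}"
    have "module_generated_by R (free_right_module R m) ?S"
      by (rule columns_generate[OF XY])
    then have "m = 0 \<or> m \<le> card ?S"
      using U unfolding unbounded_generating_number_def by blast
    moreover have "card ?S \<le> n"
      using card_image_le[of "{..<n}"] by force
    ultimately show "m \<le> n"
      by linarith
  qed
next
  assume "\<forall>m n. identity_factors R m n \<longrightarrow> m \<le> n"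
  then show "unbounded_generating_number R"
    unfolding unbounded_generating_number_def using generators_give_factorisation by blast
qed

end


section \<open>Rings presented by cosets\<close>

definition coset :: "'a::ab_group_add set \<Rightarrow> 'a \<Rightarrow> 'a set" where
  "coset I x = {y. y - x \<in> I}"

lemma coset_eq_iff:
  assumes zero: "0 \<in> I" and diff: "\<And>x y. \<lbrakk>x \<in> I; y \<in> I\<rbrakk> \<Longrightarrow> x - y \<in> I"
  shows "coset I x = coset I y \<longleftrightarrow> x - y \<in> I"
proof
  assume "coset I x = coset I y"
  moreover have "x \<in> coset I x"
    by (simp add: coset_def zero)
  ultimately show "x - y \<in> I"
    by (simp add: coset_def)
next
  assume xy: "x - y \<in> I"
  have "z - x \<in> I \<longleftrightarrow> z - y \<in> I" for z
  proof
    assume "z - x \<in> I"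
    from diff[OF this diff[OF zero xy]] show "z - y \<in> I"
      by simp
  next
    assume "z - y \<in> I"
    from diff[OF this xy] show "z - x \<in> I"
      by simp
  qed
  then show "coset I x = coset I y"
    by (simp add: coset_def)
qed

text \<open>
  A presentation describes the ring \<open>Q\<close> by representatives: addition is that of the ambient group,
  while the product of representatives is a parameter.  A ring and its twist are then presented by
  the same \<open>F\<close> and \<open>I\<close> and different products.  The unit laws hold modulo \<open>I\<close> only, since the
  representatives form an algebra without unit.
\<close>

locale ring_presentation =
  fixes F I :: "'a::ab_group_add set" and mul :: "'a \<Rightarrow> 'a \<Rightarrow> 'a" and u :: 'a
    and Q :: "'a set ring"
  assumes zero_I: "0 \<in> I"
    and diff_I: "\<lbrakk>x \<in> I; y \<in> I\<rbrakk> \<Longrightarrow> x - y \<in> I"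
    and I_F: "I \<subseteq> F"
    and diff_F: "\<lbrakk>x \<in> F; y \<in> F\<rbrakk> \<Longrightarrow> x - y \<in> F"
    and mul_F: "\<lbrakk>x \<in> F; y \<in> F\<rbrakk> \<Longrightarrow> mul x y \<in> F"
    and unit_F: "u \<in> F"
    and mul_add_left: "mul (x + y) z = mul x z + mul y z"
    and mul_add_right: "mul x (y + z) = mul x y + mul x z"
    and mul_assoc: "mul (mul x y) z = mul x (mul y z)"
    and mul_I_left: "\<lbrakk>x \<in> I; a \<in> F\<rbrakk> \<Longrightarrow> mul a x \<in> I"
    and mul_I_right: "\<lbrakk>x \<in> I; a \<in> F\<rbrakk> \<Longrightarrow> mul x a \<in> I"
    and unit_left: "x \<in> F \<Longrightarrow> mul u x - x \<in> I"
    and unit_right: "x \<in> F \<Longrightarrow> mul x u - x \<in> I"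
    and Q_carrier: "carrier Q = coset I ` F"
    and Q_one: "\<one>\<^bsub>Q\<^esub> = coset I u"
    and Q_zero: "\<zero>\<^bsub>Q\<^esub> = coset I 0"
    and Q_add: "\<lbrakk>x \<in> F; y \<in> F\<rbrakk> \<Longrightarrow> coset I x \<oplus>\<^bsub>Q\<^esub> coset I y = coset I (x + y)"
    and Q_mult: "\<lbrakk>x \<in> F; y \<in> F\<rbrakk> \<Longrightarrow> coset I x \<otimes>\<^bsub>Q\<^esub> coset I y = coset I (mul x y)"
begin

lemma zero_F: "0 \<in> F" using zero_I I_F by blast
lemma uminus_F: "x \<in> F \<Longrightarrow> - x \<in> F" using diff_F[OF zero_F] by simp
lemma add_F: "\<lbrakk>x \<in> F; y \<in> F\<rbrakk> \<Longrightarrow> x + y \<in> F" using diff_F[OF _ uminus_F] by simp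

lemma sum_F: "(\<And>j. j \<in> A \<Longrightarrow> f j \<in> F) \<Longrightarrow> sum f A \<in> F"
  by (induction A rule: infinite_finite_induct) (auto simp: zero_F add_F)

lemmas coset_eq_iff = coset_eq_iff[OF zero_I diff_I]

lemma coset_in_carrier: "x \<in> F \<Longrightarrow> coset I x \<in> carrier Q"
  by (simp add: Q_carrier)

lemma ring_Q: "ring Q"
proof (rule ringI)
  show "abelian_group Q"
  proof (rule abelian_groupI)
    fix x assume "x \<in> carrier Q"
    then obtain a where a: "a \<in> F" "x = coset I a" by (auto simp: Q_carrier)
    then have "coset I (- a) \<oplus>\<^bsub>Q\<^esub> x = \<zero>\<^bsub>Q\<^esub>"
      by (simp add: Q_add uminus_F Q_zero)
    then show "\<exists>y\<in>carrier Q. y \<oplus>\<^bsub>Q\<^esub> x = \<zero>\<^bsub>Q\<^esub>"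
      using a uminus_F coset_in_carrier by blast
  qed (auto simp: Q_carrier Q_add Q_zero add_F zero_F algebra_simps)
  show "monoid Q"
  proof (rule monoidI)
    show "\<one>\<^bsub>Q\<^esub> \<otimes>\<^bsub>Q\<^esub> x = x" "x \<otimes>\<^bsub>Q\<^esub> \<one>\<^bsub>Q\<^esub> = x" if x: "x \<in> carrier Q" for x
    proof -
      obtain a where "a \<in> F" "x = coset I a"
        using x by (auto simp: Q_carrier)
      then show "\<one>\<^bsub>Q\<^esub> \<otimes>\<^bsub>Q\<^esub> x = x" "x \<otimes>\<^bsub>Q\<^esub> \<one>\<^bsub>Q\<^esub> = x"
        by (simp_all add: Q_one Q_mult unit_F coset_eq_iff unit_left unit_right)
    qed
  qed (auto simp: Q_carrier Q_mult Q_one mul_F unit_F mul_assoc)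
qed (auto simp: Q_carrier Q_mult Q_add mul_F add_F mul_add_left mul_add_right)

sublocale Q: ring Q by (rule ring_Q)

lemma finsum_coset:
  "(\<And>j. j \<in> A \<Longrightarrow> f j \<in> F) \<Longrightarrow> (\<Oplus>\<^bsub>Q\<^esub>j\<in>A. coset I (f j)) = coset I (sum f A)"
proof (induction A rule: infinite_finite_induct)
  case (insert a A)
  then show ?case
    by (subst Q.finsum_insert) (auto simp: coset_in_carrier Q_add sum_F)
qed (simp_all add: Q_zero[symmetric] Q.finsum_infinite)

lemma identity_factors_iff:
  "identity_factors Q m n \<longleftrightarrow>
     (\<exists>X Y. (\<forall>i<m. \<forall>j<n. X i j \<in> F \<and> Y j i \<in> F) \<and>
       (\<forall>i<m. \<forall>k<m. (\<Sum>j<n. mul (X i j) (Y j k)) - (if i = k then u else 0) \<in> I))"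
    (is "_ \<longleftrightarrow> ?lifted")
proof
  assume "identity_factors Q m n"
  then obtain X Y where X: "\<And>i j. \<lbrakk>i < m; j < n\<rbrakk> \<Longrightarrow> X i j \<in> carrier Q"
    and Y: "\<And>i j. \<lbrakk>i < m; j < n\<rbrakk> \<Longrightarrow> Y j i \<in> carrier Q"
    and XY: "\<And>i k. \<lbrakk>i < m; k < m\<rbrakk> \<Longrightarrow>
      (\<Oplus>\<^bsub>Q\<^esub>j\<in>{..<n}. X i j \<otimes>\<^bsub>Q\<^esub> Y j k) = (if i = k then \<one>\<^bsub>Q\<^esub> else \<zero>\<^bsub>Q\<^esub>)"
    unfolding identity_factors_def by blast
  define lift where "lift c = (SOME x. x \<in> F \<and> c = coset I x)" for c
  have lift: "lift c \<in> F \<and> c = coset I (lift c)" if "c \<in> carrier Q" for c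
    unfolding lift_def by (rule someI_ex) (use that in \<open>auto simp: Q_carrier\<close>)
  define X' where "X' i j = lift (X i j)" for i j
  define Y' where "Y' j i = lift (Y j i)" for i j
  have X': "X' i j \<in> F \<and> X i j = coset I (X' i j)" if "i < m" "j < n" for i j
    unfolding X'_def by (intro lift X that)
  have Y': "Y' j i \<in> F \<and> Y j i = coset I (Y' j i)" if "i < m" "j < n" for i j
    unfolding Y'_def by (intro lift Y that)
  have "(\<Sum>j<n. mul (X' i j) (Y' j k)) - (if i = k then u else 0) \<in> I"
    if ik: "i < m" "k < m" for i k
  proof -
    have "coset I (\<Sum>j<n. mul (X' i j) (Y' j k)) = (\<Oplus>\<^bsub>Q\<^esub>j\<in>{..<n}. coset I (mul (X' i j) (Y' j k)))"
      using X' Y' ik by (intro finsum_coset[symmetric]) (auto intro: mul_F)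
    also have "\<dots> = (\<Oplus>\<^bsub>Q\<^esub>j\<in>{..<n}. X i j \<otimes>\<^bsub>Q\<^esub> Y j k)"
      using X' Y' ik by (intro Q.finsum_cong') (auto simp: Q_mult coset_in_carrier mul_F)
    also have "\<dots> = coset I (if i = k then u else 0)"
      using XY ik by (simp add: Q_one Q_zero)
    finally show ?thesis
      by (simp only: coset_eq_iff)
  qed
  then show ?lifted
    using X' Y' by blast
next
  assume ?lifted
  then obtain X Y where X: "\<And>i j. \<lbrakk>i < m; j < n\<rbrakk> \<Longrightarrow> X i j \<in> F"
    and Y: "\<And>i j. \<lbrakk>i < m; j < n\<rbrakk> \<Longrightarrow> Y j i \<in> F"
    and XY: "\<And>i k. \<lbrakk>i < m; k < m\<rbrakk> \<Longrightarrow>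
      (\<Sum>j<n. mul (X i j) (Y j k)) - (if i = k then u else 0) \<in> I"
    by blast
  have "(\<Oplus>\<^bsub>Q\<^esub>j\<in>{..<n}. coset I (X i j) \<otimes>\<^bsub>Q\<^esub> coset I (Y j k)) = (if i = k then \<one>\<^bsub>Q\<^esub> else \<zero>\<^bsub>Q\<^esub>)"
    if ik: "i < m" "k < m" for i k
  proof -
    have "(\<Oplus>\<^bsub>Q\<^esub>j\<in>{..<n}. coset I (X i j) \<otimes>\<^bsub>Q\<^esub> coset I (Y j k))
        = (\<Oplus>\<^bsub>Q\<^esub>j\<in>{..<n}. coset I (mul (X i j) (Y j k)))"
      using X Y ik by (intro Q.finsum_cong') (auto simp: Q_mult coset_in_carrier mul_F)
    also have "\<dots> = coset I (\<Sum>j<n. mul (X i j) (Y j k))"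
      using X Y ik by (intro finsum_coset) (auto intro: mul_F)
    also have "\<dots> = coset I (if i = k then u else 0)"
      using XY[OF ik] by (simp only: coset_eq_iff)
    finally show ?thesis
      by (simp add: Q_one Q_zero)
  qed
  then show "identity_factors Q m n"
    unfolding identity_factors_def using X Y
    by (intro exI[of _ "\<lambda>i j. coset I (X i j)"] exI[of _ "\<lambda>j k. coset I (Y j k)"])
      (simp add: coset_in_carrier)
qed

end

lemma sum_div_mod:
  fixes f :: "nat \<Rightarrow> nat \<Rightarrow> 'a::comm_monoid_add"
  shows "(\<Sum>q<n * N. f (q div N) (q mod N)) = (\<Sum>j<n. \<Sum>t<N. f j t)"
proof -
  have "(\<Sum>q<n * N. f (q div N) (q mod N)) = (\<Sum>j<n. \<Sum>q=j * N..<j * N + N. f (q div N) (q mod N))"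
    by (rule sum.nat_group[symmetric])
  also have "\<dots> = (\<Sum>j<n. \<Sum>t<N. f j t)"
  proof (rule sum.cong[OF refl])
    fix j
    have "(\<Sum>q=j * N..<j * N + N. f (q div N) (q mod N))
        = (\<Sum>t=0..<N. f ((t + j * N) div N) ((t + j * N) mod N))"
      using sum.shift_bounds_nat_ivl[of "\<lambda>q. f (q div N) (q mod N)" 0 "j * N" N]
      by (simp add: add.commute)
    also have "\<dots> = (\<Sum>t<N. f j t)"
      by (intro sum.cong) auto
    finally show "(\<Sum>q=j * N..<j * N + N. f (q div N) (q mod N)) = (\<Sum>t<N. f j t)" .
  qed
  finally show ?thesis .
qed

text \<open>
  The hypotheses say that \<open>\<rho>\<close> induces a unital homomorphism from \<open>Q\<close> to the $N \times N$ matrices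
  over \<open>Q'\<close>.  A row or column index of a block matrix is $p = (p \mathbin{\mathrm{div}} N) N +
  (p \bmod N)$: the quotient selects the block and the remainder the place in the block.
\<close>

theorem unbounded_generating_number_along_matrix_hom:
  fixes \<rho> :: "nat \<Rightarrow> nat \<Rightarrow> 'a::ab_group_add \<Rightarrow> 'b::ab_group_add"
  assumes P: "ring_presentation F I mul u Q" and P': "ring_presentation F' I' mul' u' Q'"
    and N: "N > 0"
    and \<rho>_add: "\<And>i j x y. \<rho> i j (x + y) = \<rho> i j x + \<rho> i j y"
    and \<rho>_F: "\<And>i j x. x \<in> F \<Longrightarrow> \<rho> i j x \<in> F'"
    and \<rho>_I: "\<And>i j x. x \<in> I \<Longrightarrow> \<rho> i j x \<in> I'"
    and \<rho>_mul: "\<And>i k x y. \<lbrakk>i < N; k < N\<rbrakk> \<Longrightarrow>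
      \<rho> i k (mul x y) = (\<Sum>j<N. mul' (\<rho> i j x) (\<rho> j k y))"
    and \<rho>_unit: "\<And>i j. \<lbrakk>i < N; j < N\<rbrakk> \<Longrightarrow> \<rho> i j u = (if i = j then u' else 0)"
    and U: "unbounded_generating_number Q'"
  shows "unbounded_generating_number Q"
proof -
  interpret P: ring_presentation F I mul u Q by (rule P)
  interpret P': ring_presentation F' I' mul' u' Q' by (rule P')
  have \<rho>_0: "\<rho> i j 0 = 0" for i j
    using \<rho>_add[of i j 0 0] by simp
  have \<rho>_diff: "\<rho> i j (x - y) = \<rho> i j x - \<rho> i j y" for i j x y
    using \<rho>_add[of i j "x - y" y] by (simp add: algebra_simps)
  have \<rho>_sum: "\<rho> i j (sum f A) = (\<Sum>a\<in>A. \<rho> i j (f a))" for i j and f :: "nat \<Rightarrow> 'a" and A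
    by (induction A rule: infinite_finite_induct) (auto simp: \<rho>_0 \<rho>_add)
  have "m \<le> n" if factors: "identity_factors Q m n" for m n
  proof -
    obtain X Y where X: "\<And>i j. \<lbrakk>i < m; j < n\<rbrakk> \<Longrightarrow> X i j \<in> F"
      and Y: "\<And>i j. \<lbrakk>i < m; j < n\<rbrakk> \<Longrightarrow> Y j i \<in> F"
      and XY: "\<And>i k. \<lbrakk>i < m; k < m\<rbrakk> \<Longrightarrow>
        (\<Sum>j<n. mul (X i j) (Y j k)) - (if i = k then u else 0) \<in> I"
      using factors unfolding P.identity_factors_iff by blast
    define X' where "X' p q = \<rho> (p mod N) (q mod N) (X (p div N) (q div N))" for p q
    define Y' where "Y' q p = \<rho> (q mod N) (p mod N) (Y (q div N) (p div N))" for p q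
    have div: "p div N < k" if "p < k * N" for p k
      using that by (simp add: less_mult_imp_div_less)
    have "identity_factors Q' (m * N) (n * N)"
      unfolding P'.identity_factors_iff
    proof (rule exI[of _ X'], rule exI[of _ Y'], intro conjI allI impI)
      fix p r assume p: "p < m * N" and r: "r < m * N"
      have mods: "p mod N < N" "r mod N < N"
        using N by auto
      have "(\<Sum>q<n * N. mul' (X' p q) (Y' q r))
          = (\<Sum>j<n. \<Sum>t<N. mul' (\<rho> (p mod N) t (X (p div N) j)) (\<rho> t (r mod N) (Y j (r div N))))"
        unfolding X'_def Y'_def by (rule sum_div_mod)
      also have "\<dots> = \<rho> (p mod N) (r mod N) (\<Sum>j<n. mul (X (p div N) j) (Y j (r div N)))"
        using mods by (simp add: \<rho>_sum \<rho>_mul)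
      finally have "(\<Sum>q<n * N. mul' (X' p q) (Y' q r)) - \<rho> (p mod N) (r mod N) (if p div N = r div N then u else 0)
          = \<rho> (p mod N) (r mod N) ((\<Sum>j<n. mul (X (p div N) j) (Y j (r div N)))
              - (if p div N = r div N then u else 0))"
        by (simp add: \<rho>_diff)
      also have "\<dots> \<in> I'"
        by (intro \<rho>_I XY div p r)
      finally have "(\<Sum>q<n * N. mul' (X' p q) (Y' q r))
          - \<rho> (p mod N) (r mod N) (if p div N = r div N then u else 0) \<in> I'" .
      moreover have "\<rho> (p mod N) (r mod N) (if p div N = r div N then u else 0) = (if p = r then u' else 0)"
        using mods by (auto simp: \<rho>_0 \<rho>_unit) (metis div_mult_mod_eq)
      ultimately show "(\<Sum>q<n * N. mul' (X' p q) (Y' q r)) - (if p = r then u' else 0) \<in> I'"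
        by simp
    qed (auto simp: X'_def Y'_def intro!: \<rho>_F X Y div)
    then have "m * N \<le> n * N"
      using U P'.Q.unbounded_generating_number_iff by blast
    then show "m \<le> n"
      using N by simp
  qed
  then show ?thesis
    using P.Q.unbounded_generating_number_iff by blast
qed


section \<open>Polynomials on words\<close>

definition linear_extension :: "('w \<Rightarrow> 'k::zero \<Rightarrow> 'a::comm_monoid_add) \<Rightarrow> ('w \<Rightarrow>\<^sub>0 'k) \<Rightarrow> 'a" where
  "linear_extension f x = (\<Sum>w\<in>Poly_Mapping.keys x. f w (Poly_Mapping.lookup x w))"

lemma linear_extension_add:
  fixes x y :: "'w \<Rightarrow>\<^sub>0 'k::monoid_add"
  assumes "\<And>w. f w 0 = 0" "\<And>w a b. f w (a + b) = f w a + f w b"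
  shows "linear_extension f (x + y) = linear_extension f x + linear_extension f y"
  unfolding linear_extension_def by (rule setsum_keys_plus_distrib) (use assms in auto)

lemma linear_extension_single:
  "f w 0 = 0 \<Longrightarrow> linear_extension f (Poly_Mapping.single w a) = f w a"
  by (simp add: linear_extension_def)

text \<open>
  The alternative \<open>a = 0\<close> makes the rule apply to the zero polynomial also when \<open>S\<close> is empty.
\<close>

lemma keys_induct [consumes 1, case_names single add]:
  fixes x :: "'w \<Rightarrow>\<^sub>0 'k::monoid_add"
  assumes keys: "Poly_Mapping.keys x \<subseteq> S"
    and single: "\<And>w a. w \<in> S \<or> a = 0 \<Longrightarrow> P (Poly_Mapping.single w a)"
    and add: "\<And>x y. \<lbrakk>P x; P y\<rbrakk> \<Longrightarrow> P (x + y)"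
  shows "P x"
  using keys
proof (induction x rule: Poly_Mapping.update_induct)
  case const
  then show ?case using single[of undefined 0] by simp
next
  case (update f a b)
  have eq: "Poly_Mapping.update a b f = Poly_Mapping.single a b + f"
  proof (rule poly_mapping_eqI)
    fix k
    show "Poly_Mapping.lookup (Poly_Mapping.update a b f) k = Poly_Mapping.lookup (Poly_Mapping.single a b + f) k"
      using update.hyps by (auto simp: lookup_update lookup_add lookup_single in_keys_iff)
  qed
  have "Poly_Mapping.keys (Poly_Mapping.update a b f) = insert a (Poly_Mapping.keys f)"
    using update.hyps by (simp add: keys_update)
  then show ?case
    using update unfolding eq by (intro add single) auto
qed

lemmas single_induct = keys_induct[OF subset_UNIV, case_names single add]

lemma additive_sum:
  fixes f :: "'a::ab_group_add \<Rightarrow> 'b::ab_group_add"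
  assumes "\<And>x y. f (x + y) = f x + f y"
  shows "f (sum g A) = (\<Sum>a\<in>A. f (g a))"
proof -
  have "f 0 = 0"
    using assms[of 0 0] by simp
  then show ?thesis
    by (induction A rule: infinite_finite_induct) (auto simp: assms)
qed

lemma additive_diff:
  fixes f :: "'a::ab_group_add \<Rightarrow> 'b::ab_group_add"
  assumes "\<And>x y. f (x + y) = f x + f y"
  shows "f (x - y) = f x - f y"
  using assms[of "x - y" y] by (simp add: algebra_simps)

definition relabel :: "('x \<Rightarrow> 'y) \<Rightarrow> ('x list \<Rightarrow>\<^sub>0 'k::field) \<Rightarrow> ('y list \<Rightarrow>\<^sub>0 'k)" where
  "relabel h = linear_extension (\<lambda>w. Poly_Mapping.single (map h w))"

lemma relabel_add: "relabel h (x + y) = relabel h x + relabel h y"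
  unfolding relabel_def by (rule linear_extension_add) (simp_all add: single_add)

lemmas relabel_sum = additive_sum[of "relabel h" for h, OF relabel_add]
lemmas relabel_diff = additive_diff[of "relabel h" for h, OF relabel_add]

lemma relabel_single [simp]:
  "relabel h (Poly_Mapping.single w a) = Poly_Mapping.single (map h w) a"
  unfolding relabel_def by (rule linear_extension_single) simp

lemma relabel_0 [simp]: "relabel h 0 = 0"
  by (simp add: relabel_def linear_extension_def)

lemma relabel_mult: "relabel h (x * y) = relabel h x * relabel h y"
proof (induction x rule: single_induct)
  case (single w a)
  show ?case
    by (induction y rule: single_induct)
      (auto simp: mult_single plus_list_def relabel_add distrib_left)
qed (simp add: relabel_add distrib_right)

lemma relabel_relabel: "relabel h (relabel h' x) = relabel (h \<circ> h') x"
  by (induction x rule: single_induct) (simp_all add: relabel_add comp_def)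

lemma relabel_id: "relabel id x = x"
  by (induction x rule: single_induct) (simp_all add: relabel_add)

lemma relabel_cong:
  "(\<And>w y. \<lbrakk>w \<in> Poly_Mapping.keys x; y \<in> set w\<rbrakk> \<Longrightarrow> h y = h' y) \<Longrightarrow> relabel h x = relabel h' x"
  unfolding relabel_def linear_extension_def by (intro sum.cong arg_cong2[of _ _ _ _ Poly_Mapping.single]) auto

lemma relabel_gen: "relabel h (gen y) = gen (h y)"
  by (simp add: gen_def)

lemma free_map_eq_relabel: "free_map \<sigma> = relabel (gen_map \<sigma>)"
  by (simp add: fun_eq_iff free_map_def relabel_def linear_extension_def)

text \<open>
  Sets of degrees, rather than single degrees, are needed because the matrix entries below collect
  the homogeneous parts in a residue class of degrees.
\<close>

definition part :: "int set \<Rightarrow> ('v, 'e, 'k::field) path_poly \<Rightarrow> ('v, 'e, 'k) path_poly" where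
  "part D = linear_extension (\<lambda>w a. if word_degree w \<in> D then Poly_Mapping.single w a else 0)"

lemma part_add: "part D (x + y) = part D x + part D y"
  unfolding part_def by (rule linear_extension_add) (simp_all add: single_add)

lemmas part_sum = additive_sum[of "part D" for D, OF part_add]
lemmas part_diff = additive_diff[of "part D" for D, OF part_add]

lemma part_single:
  "part D (Poly_Mapping.single w a) = (if word_degree w \<in> D then Poly_Mapping.single w a else 0)"
  unfolding part_def by (rule linear_extension_single) simp

lemma part_0 [simp]: "part D 0 = 0"
  by (simp add: part_def linear_extension_def)

lemma part_part: "part C (part D x) = part (C \<inter> D) x"
  by (induction x rule: single_induct) (auto simp: part_single part_add)

lemma lookup_part:
  "Poly_Mapping.lookup (part D x) w = (if word_degree w \<in> D then Poly_Mapping.lookup x w else 0)"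
  by (induction x rule: single_induct) (auto simp: part_single part_add lookup_add lookup_single when_def)

lemma keys_part: "Poly_Mapping.keys (part D x) = {w \<in> Poly_Mapping.keys x. word_degree w \<in> D}"
  by (auto simp: in_keys_iff lookup_part split: if_splits)

lemma part_eq_self: "(\<And>w. w \<in> Poly_Mapping.keys x \<Longrightarrow> word_degree w \<in> D) \<Longrightarrow> part D x = x"
  by (rule poly_mapping_eqI) (auto simp: lookup_part in_keys_iff)

lemma part_empty: "part {} x = 0"
  by (rule poly_mapping_eqI) (simp add: lookup_part)

lemma part_outside: "m \<notin> word_degree ` Poly_Mapping.keys x \<Longrightarrow> part {m} x = 0"
  by (rule poly_mapping_eqI) (auto simp: lookup_part in_keys_iff)

lemma word_degree_append [simp]: "word_degree (v @ w) = word_degree v + word_degree w"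
  by (simp add: word_degree_def)

lemma part_single_mult:
  "part D (Poly_Mapping.single w a * x) = Poly_Mapping.single w a * part {d. word_degree w + d \<in> D} x"
  by (induction x rule: single_induct)
    (auto simp: part_single part_add mult_single plus_list_def distrib_left)

lemma part_mult_single:
  "part D (x * Poly_Mapping.single w a) = part {d. d + word_degree w \<in> D} x * Poly_Mapping.single w a"
  by (induction x rule: single_induct)
    (auto simp: part_single part_add mult_single plus_list_def distrib_right)

lemma sum_singles: "(\<Sum>w\<in>Poly_Mapping.keys x. Poly_Mapping.single w (Poly_Mapping.lookup x w)) = x"
proof -
  have "linear_extension Poly_Mapping.single x = x"
    by (induction x rule: single_induct)
      (simp_all add: linear_extension_add linear_extension_single single_add)
  then show ?thesis
    by (simp add: linear_extension_def)
qed

lemma part_eq_sum: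
  "part D x = (\<Sum>w\<in>{w \<in> Poly_Mapping.keys x. word_degree w \<in> D}. Poly_Mapping.single w (Poly_Mapping.lookup x w))"
  unfolding part_def linear_extension_def by (rule sum.inter_filter[symmetric]) simp

lemma sum_parts: "(\<Sum>m\<in>word_degree ` Poly_Mapping.keys x. part {m} x) = x"
proof -
  have "(\<Sum>m\<in>word_degree ` Poly_Mapping.keys x. part {m} x)
      = (\<Sum>w\<in>Poly_Mapping.keys x. Poly_Mapping.single w (Poly_Mapping.lookup x w))"
    unfolding part_eq_sum by (subst (2) sum.image_gen[of _ _ word_degree]) auto
  then show ?thesis
    by (simp add: sum_singles)
qed


section \<open>The ideal of a Leavitt path algebra\<close>

lemma scale_eq_mult: "Poly_Mapping.map ((*) c) x = Poly_Mapping.single [] c * (x :: ('v, 'e, 'k::field) path_poly)"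
  using mult_map_scale_conv_mult[of c x] by (simp add: zero_list_def)

lemma single_Nil_commute: "x * Poly_Mapping.single [] c = Poly_Mapping.single [] c * (x :: ('v, 'e, 'k::field) path_poly)"
  by (induction x rule: single_induct) (simp_all add: mult_single plus_list_def distrib_left distrib_right mult.commute)

lemma scale_uminus: "Poly_Mapping.map ((*) (-1)) x = - (x :: ('v, 'e, 'k::field) path_poly)"
proof -
  have "Poly_Mapping.single [] (-1 :: 'k) = (-1 :: ('v, 'e, 'k) path_poly)"
    by (simp add: single_uminus flip: zero_list_def)
  then show ?thesis
    by (simp add: scale_eq_mult)
qed

lemma single_in_free_carrier:
  "\<lbrakk>w \<noteq> []; set w \<subseteq> generators E\<rbrakk> \<Longrightarrow> Poly_Mapping.single w a \<in> free_carrier E"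
  by (simp add: free_carrier_def)

lemma zero_in_free_carrier: "0 \<in> free_carrier E"
  by (simp add: free_carrier_def)

lemma add_in_free_carrier:
  "\<lbrakk>x \<in> free_carrier E; y \<in> free_carrier E\<rbrakk> \<Longrightarrow> x + y \<in> free_carrier E"
  using keys_add[of x y] by (auto simp: free_carrier_def)

lemma diff_in_free_carrier:
  "\<lbrakk>x \<in> free_carrier E; y \<in> free_carrier E\<rbrakk> \<Longrightarrow> x - y \<in> free_carrier E"
  using keys_diff[of x y] by (auto simp: free_carrier_def)

lemma sum_in_free_carrier:
  "(\<And>a. a \<in> A \<Longrightarrow> f a \<in> free_carrier E) \<Longrightarrow> sum f A \<in> free_carrier E"
  by (induction A rule: infinite_finite_induct) (auto simp: zero_in_free_carrier add_in_free_carrier)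

lemma mult_in_free_carrier:
  "\<lbrakk>x \<in> free_carrier E; y \<in> free_carrier E\<rbrakk> \<Longrightarrow> x * y \<in> free_carrier E"
  using keys_mult[of x y] by (fastforce simp: free_carrier_def plus_list_def)

lemma part_in_free_carrier: "x \<in> free_carrier E \<Longrightarrow> part D x \<in> free_carrier E"
  by (auto simp: free_carrier_def keys_part)

lemma free_carrier_induct [consumes 1, case_names single zero add]:
  assumes "x \<in> free_carrier E"
    and "\<And>w a. \<lbrakk>w \<noteq> []; set w \<subseteq> generators E\<rbrakk> \<Longrightarrow> P (Poly_Mapping.single w a)"
    and "P 0"
    and "\<And>x y. \<lbrakk>P x; P y\<rbrakk> \<Longrightarrow> P (x + y)"
  shows "P x"
proof (rule keys_induct[of x "{w. w \<noteq> [] \<and> set w \<subseteq> generators E}"])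
  show "Poly_Mapping.keys x \<subseteq> {w. w \<noteq> [] \<and> set w \<subseteq> generators E}"
    using assms(1) by (auto simp: free_carrier_def)
qed (use assms in auto)

lemma uminus_in_leavitt_ideal: "x \<in> leavitt_ideal E \<Longrightarrow> - x \<in> leavitt_ideal E"
  using leavitt_ideal.scale[of x E "-1"] by (simp add: scale_uminus)

lemma diff_in_leavitt_ideal:
  "\<lbrakk>x \<in> leavitt_ideal E; y \<in> leavitt_ideal E\<rbrakk> \<Longrightarrow> x - y \<in> leavitt_ideal E"
  using leavitt_ideal.add[OF _ uminus_in_leavitt_ideal] by fastforce

lemma sum_in_leavitt_ideal:
  "(\<And>a. a \<in> A \<Longrightarrow> f a \<in> leavitt_ideal E) \<Longrightarrow> sum f A \<in> leavitt_ideal E"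
  by (induction A rule: infinite_finite_induct) (auto intro: leavitt_ideal.zero leavitt_ideal.add)

lemma single_mult_in_leavitt_ideal:
  "\<lbrakk>x \<in> leavitt_ideal E; set w \<subseteq> generators E\<rbrakk> \<Longrightarrow> Poly_Mapping.single w a * x \<in> leavitt_ideal E"
  using leavitt_ideal.scale[of x E a]
  by (cases "w = []") (auto simp: scale_eq_mult intro: leavitt_ideal.mult_left single_in_free_carrier)

lemma mult_single_in_leavitt_ideal:
  "\<lbrakk>x \<in> leavitt_ideal E; set w \<subseteq> generators E\<rbrakk> \<Longrightarrow> x * Poly_Mapping.single w a \<in> leavitt_ideal E"
  using leavitt_ideal.scale[of x E a]
  by (cases "w = []")
    (auto simp: scale_eq_mult single_Nil_commute intro: leavitt_ideal.mult_right single_in_free_carrier)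

lemma gen_in_free_carrier: "y \<in> generators E \<Longrightarrow> gen y \<in> free_carrier E"
  unfolding gen_def by (rule single_in_free_carrier) auto

lemma part_gen: "part D (gen y) = (if gen_degree y \<in> D then gen y else 0)"
  by (simp add: gen_def part_single word_degree_def)

lemma part_gen_mult:
  "part D (gen y * gen z) = (if gen_degree y + gen_degree z \<in> D then gen y * gen z else 0)"
  by (simp add: gen_def part_single word_degree_def mult_single plus_list_def)

lemma part_relation:
  assumes "r \<in> leavitt_relations E"
  shows "part D r = r \<or> part D r = 0"
  using assms
proof cases
  case (regular v)
  then show ?thesis
    by (cases "0 \<in> D") (simp_all add: part_diff part_sum part_gen part_gen_mult)
qed (auto simp: part_diff part_gen part_gen_mult)

text \<open>
  The ideal is graded, since it is generated by homogeneous elements.  In the induction, a factor from the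
  free algebra is decomposed into words, because multiplication by a word shifts degrees by
  a constant.
\<close>

lemma part_in_leavitt_ideal:
  assumes "x \<in> leavitt_ideal E"
  shows "part D x \<in> leavitt_ideal E"
  using assms
proof (induction arbitrary: D rule: leavitt_ideal.induct)
  case (relation r)
  then show ?case
    using part_relation[OF relation, of D] by (auto intro: leavitt_ideal.relation leavitt_ideal.zero)
next
  case (scale x c)
  then show ?case
    by (auto simp: scale_eq_mult part_single_mult intro!: single_mult_in_leavitt_ideal)
next
  case (mult_left x a)
  from mult_left(2) show ?case
    by (induction rule: free_carrier_induct)
      (auto simp: part_single_mult distrib_right part_add
        intro!: leavitt_ideal.zero leavitt_ideal.add single_mult_in_leavitt_ideal mult_left.IH)
next
  case (mult_right x a)
  from mult_right(2) show ?case
    by (induction rule: free_carrier_induct)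
      (auto simp: part_mult_single distrib_left part_add
        intro!: leavitt_ideal.zero leavitt_ideal.add mult_single_in_leavitt_ideal mult_right.IH)
qed (auto simp: part_add intro: leavitt_ideal.zero leavitt_ideal.add)

text \<open>
  The class of this element is the unit of the Leavitt path algebra.
\<close>

definition local_unit :: "('v, 'e) pre_digraph \<Rightarrow> ('v, 'e, 'k::field) path_poly" where
  "local_unit E = (\<Sum>v\<in>verts E. gen (Vertex v))"

context fin_digraph
begin

lemma relations_in_free_carrier: "leavitt_relations G \<subseteq> free_carrier G"
proof
  fix r :: "('a, 'b, 'k::field) path_poly"
  assume r: "r \<in> leavitt_relations G"
  have V: "gen (Vertex v) \<in> free_carrier G" if "v \<in> verts G" for v
    using that by (intro gen_in_free_carrier) (simp add: generators_def)
  have E: "gen (Edge e) \<in> free_carrier G" "gen (Ghost e) \<in> free_carrier G" if "e \<in> arcs G" for e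
    using that by (auto intro!: gen_in_free_carrier simp: generators_def)
  note closed = diff_in_free_carrier mult_in_free_carrier sum_in_free_carrier
  from r show "r \<in> free_carrier G"
  proof cases
    case (regular v)
    then show ?thesis
      by (auto simp: regular_vertex_def intro!: closed V E)
  qed (auto simp: zero_in_free_carrier intro!: closed V E)
qed

lemma leavitt_ideal_in_free_carrier: "leavitt_ideal G \<subseteq> free_carrier G"
proof
  fix x :: "('a, 'b, 'k::field) path_poly"
  assume "x \<in> leavitt_ideal G"
  then show "x \<in> free_carrier G"
  proof induction
    case (scale x c)
    have "Poly_Mapping.keys (Poly_Mapping.map ((*) c) x) \<subseteq> Poly_Mapping.keys x"
      by transfer (auto simp: when_def)
    with scale.IH show ?case
      unfolding free_carrier_def by blast
  qed (use relations_in_free_carrier in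
      \<open>auto intro: zero_in_free_carrier add_in_free_carrier mult_in_free_carrier\<close>)
qed

lemma vertex_absorbs_left:
  assumes "y \<in> generators G"
  shows "\<exists>s\<in>verts G. gen (Vertex s) * gen y - gen y \<in> leavitt_ideal G"
proof -
  consider v where "v \<in> verts G" "y = Vertex v" | e where "e \<in> arcs G" "y = Edge e"
    | e where "e \<in> arcs G" "y = Ghost e"
    using assms by (auto simp: generators_def)
  then show ?thesis
  proof cases
    case (1 v)
    with leavitt_relations.vertices[of v G v] show ?thesis
      by (auto intro: leavitt_ideal.relation)
  next
    case (2 e)
    with leavitt_relations.edge_source[of e G] show ?thesis
      by (auto intro!: bexI[of _ "tail G e"] leavitt_ideal.relation)
  next
    case (3 e)
    with leavitt_relations.ghost_range[of e G] show ?thesis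
      by (auto intro!: bexI[of _ "head G e"] leavitt_ideal.relation)
  qed
qed

lemma vertex_absorbs_right:
  assumes "y \<in> generators G"
  shows "\<exists>s\<in>verts G. gen y * gen (Vertex s) - gen y \<in> leavitt_ideal G"
proof -
  consider v where "v \<in> verts G" "y = Vertex v" | e where "e \<in> arcs G" "y = Edge e"
    | e where "e \<in> arcs G" "y = Ghost e"
    using assms by (auto simp: generators_def)
  then show ?thesis
  proof cases
    case (1 v)
    with leavitt_relations.vertices[of v G v] show ?thesis
      by (auto intro: leavitt_ideal.relation)
  next
    case (2 e)
    with leavitt_relations.edge_range[of e G] show ?thesis
      by (auto intro!: bexI[of _ "head G e"] leavitt_ideal.relation)
  next
    case (3 e)
    with leavitt_relations.ghost_source[of e G] show ?thesis
      by (auto intro!: bexI[of _ "tail G e"] leavitt_ideal.relation)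
  qed
qed

text \<open>
  Some vertex \<open>s\<close> satisfies $s y \equiv y$.  By orthogonality of the vertices, $v y \equiv v s y
  \equiv \delta_{v,s}\, y$ for every vertex \<open>v\<close>, and these sum to \<open>y\<close>.
\<close>

lemma local_unit_left:
  assumes y: "y \<in> generators G"
  shows "local_unit G * gen y - gen y \<in> leavitt_ideal G" (is "_ * ?y - _ \<in> ?I")
proof -
  obtain s where s: "s \<in> verts G" "gen (Vertex s) * ?y - ?y \<in> ?I"
    using vertex_absorbs_left[OF y] by blast
  have "gen (Vertex v) * ?y - (if v = s then ?y else 0) \<in> ?I" if v: "v \<in> verts G" for v
  proof -
    have vs: "gen (Vertex v) * gen (Vertex s) - (if v = s then gen (Vertex s) else 0) \<in> ?I"
      (is "?vs \<in> _")
      by (intro leavitt_ideal.relation leavitt_relations.vertices v s)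
    have "?vs * ?y - gen (Vertex v) * (gen (Vertex s) * ?y - ?y) +
        (if v = s then gen (Vertex s) * ?y - ?y else 0) \<in> ?I"
    proof (rule leavitt_ideal.add)
      have "?y \<in> free_carrier G" "gen (Vertex v) \<in> free_carrier G"
        using v y by (auto intro!: gen_in_free_carrier simp: generators_def)
      then show "?vs * ?y - gen (Vertex v) * (gen (Vertex s) * ?y - ?y) \<in> ?I"
        by (intro diff_in_leavitt_ideal leavitt_ideal.mult_left[OF s(2)] leavitt_ideal.mult_right[OF vs])
    qed (use s in \<open>auto intro: leavitt_ideal.zero\<close>)
    then show ?thesis
      by (auto simp: algebra_simps split: if_splits)
  qed
  then have "(\<Sum>v\<in>verts G. gen (Vertex v) * ?y - (if v = s then ?y else 0)) \<in> ?I"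
    by (rule sum_in_leavitt_ideal)
  then show ?thesis
    using s by (simp add: local_unit_def sum_subtractf sum_distrib_right)
qed

lemma local_unit_right:
  assumes y: "y \<in> generators G"
  shows "gen y * local_unit G - gen y \<in> leavitt_ideal G" (is "?y * _ - _ \<in> ?I")
proof -
  obtain s where s: "s \<in> verts G" "?y * gen (Vertex s) - ?y \<in> ?I"
    using vertex_absorbs_right[OF y] by blast
  have "?y * gen (Vertex v) - (if s = v then ?y else 0) \<in> ?I" if v: "v \<in> verts G" for v
  proof -
    have sv: "gen (Vertex s) * gen (Vertex v) - (if s = v then gen (Vertex v) else 0) \<in> ?I"
      (is "?sv \<in> _")
      by (intro leavitt_ideal.relation leavitt_relations.vertices v s)
    have "?y * ?sv - (?y * gen (Vertex s) - ?y) * gen (Vertex v) +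
        (if s = v then ?y * gen (Vertex s) - ?y else 0) \<in> ?I"
    proof (rule leavitt_ideal.add)
      have "?y \<in> free_carrier G" "gen (Vertex v) \<in> free_carrier G"
        using v y by (auto intro!: gen_in_free_carrier simp: generators_def)
      then show "?y * ?sv - (?y * gen (Vertex s) - ?y) * gen (Vertex v) \<in> ?I"
        by (intro diff_in_leavitt_ideal leavitt_ideal.mult_right[OF s(2)] leavitt_ideal.mult_left[OF sv])
    qed (use s in \<open>auto intro: leavitt_ideal.zero\<close>)
    then show ?thesis
      by (auto simp: algebra_simps split: if_splits)
  qed
  then have "(\<Sum>v\<in>verts G. ?y * gen (Vertex v) - (if s = v then ?y else 0)) \<in> ?I"
    by (rule sum_in_leavitt_ideal)
  then show ?thesis
    using s by (simp add: local_unit_def sum_subtractf sum_distrib_left)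
qed

lemma local_unit_mult:
  assumes "x \<in> free_carrier G"
  shows "local_unit G * x - x \<in> leavitt_ideal G"
  using assms
proof (induction rule: free_carrier_induct)
  case (single w a)
  then obtain y z where w: "w = y # z"
    by (cases w) auto
  have "Poly_Mapping.single w a = gen y * Poly_Mapping.single z a"
    by (simp add: w gen_def mult_single plus_list_def)
  then have "local_unit G * Poly_Mapping.single w a - Poly_Mapping.single w a
      = (local_unit G * gen y - gen y) * Poly_Mapping.single z a"
    by (simp add: algebra_simps)
  also have "\<dots> \<in> leavitt_ideal G"
    using single w by (intro mult_single_in_leavitt_ideal local_unit_left) auto
  finally show ?case .
next
  case (add x y)
  then show ?case
    using leavitt_ideal.add[OF add] by (simp add: algebra_simps)
qed (simp add: leavitt_ideal.zero)

lemma mult_local_unit: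
  assumes "x \<in> free_carrier G"
  shows "x * local_unit G - x \<in> leavitt_ideal G"
  using assms
proof (induction rule: free_carrier_induct)
  case (single w a)
  then obtain y z where w: "w = z @ [y]"
    by (cases w rule: rev_cases) auto
  have "Poly_Mapping.single w a = Poly_Mapping.single z a * gen y"
    by (simp add: w gen_def mult_single plus_list_def)
  then have "Poly_Mapping.single w a * local_unit G - Poly_Mapping.single w a
      = Poly_Mapping.single z a * (gen y * local_unit G - gen y)"
    by (simp add: algebra_simps)
  also have "\<dots> \<in> leavitt_ideal G"
    using single w by (intro single_mult_in_leavitt_ideal local_unit_right) auto
  finally show ?case .
next
  case (add x y)
  then show ?case
    using leavitt_ideal.add[OF add] by (simp add: algebra_simps)
qed (simp add: leavitt_ideal.zero)

end


section \<open>Twists of the path algebra by a periodic relabelling\<close>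

text \<open>
  The map \<open>g\<close> is periodic on all letters, also on those that are not generators of the algebra of
  \<open>E\<close>.  Identities between its powers then hold without side conditions on words.
\<close>

locale periodic_relabelling = fin_digraph E
  for E :: "('v, 'e) pre_digraph" +
  fixes K :: "'k::field itself"
    and g :: "('v, 'e) lpa_gen \<Rightarrow> ('v, 'e) lpa_gen"
    and N :: nat
  assumes N_pos: "N > 0"
    and periodic: "g ^^ N = id"
    and degree_g: "gen_degree (g y) = gen_degree y"
    and g_generators: "y \<in> generators E \<Longrightarrow> g y \<in> generators E"
    and g_relations: "r \<in> (leavitt_relations E :: ('v, 'e, 'k) path_poly set) \<Longrightarrow>
      relabel g r \<in> leavitt_ideal E"
    and g_local_unit: "relabel g (local_unit E) = (local_unit E :: ('v, 'e, 'k) path_poly)"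
begin

abbreviation F :: "('v, 'e, 'k) path_poly set" where "F \<equiv> free_carrier E"
abbreviation I :: "('v, 'e, 'k) path_poly set" where "I \<equiv> leavitt_ideal E"
abbreviation u :: "('v, 'e, 'k) path_poly" where "u \<equiv> local_unit E"

text \<open>
  Reducing the exponent modulo the period yields negative powers without an inverse function.
\<close>

definition iterate :: "int \<Rightarrow> ('v, 'e) lpa_gen \<Rightarrow> ('v, 'e) lpa_gen" where
  "iterate m = g ^^ nat (m mod int N)"

definition shift :: "int \<Rightarrow> ('v, 'e, 'k) path_poly \<Rightarrow> ('v, 'e, 'k) path_poly" where
  "shift m = relabel (iterate m)"

lemma funpow_g_mod: "g ^^ (n mod N) = g ^^ n"
proof -
  have "g ^^ (N * q) = id" for q
    by (induction q) (simp_all add: funpow_add periodic)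
  then have "g ^^ (N * (n div N) + n mod N) = g ^^ (n mod N)"
    by (simp only: funpow_add id_comp)
  then show ?thesis
    by simp
qed

lemma iterate_of_nat: "iterate (int n) = g ^^ n"
  unfolding iterate_def by (simp add: funpow_g_mod flip: zmod_int)

lemma iterate_cong: "m mod int N = n mod int N \<Longrightarrow> iterate m = iterate n"
  by (simp add: iterate_def)

lemma iterate_add: "iterate (m + n) = iterate m \<circ> iterate n"
proof -
  have nonneg: "0 \<le> k mod int N" for k
    using N_pos by simp
  have "iterate m \<circ> iterate n = iterate (int (nat (m mod int N) + nat (n mod int N)))"
    unfolding iterate_of_nat funpow_add by (simp only: iterate_def)
  also have "\<dots> = iterate (m + n)"
    using nonneg by (intro iterate_cong) (simp add: mod_add_eq)
  finally show ?thesis ..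
qed

lemma iterate_0 [simp]: "iterate 0 = id"
  by (simp add: iterate_def)

lemma iterate_1: "iterate 1 = g"
  using iterate_of_nat[of 1] by simp

lemma degree_iterate: "gen_degree (iterate m y) = gen_degree y"
proof -
  have "gen_degree ((g ^^ n) y) = gen_degree y" for n
    by (induction n) (simp_all add: degree_g)
  then show ?thesis
    by (simp add: iterate_def)
qed

lemma word_degree_iterate [simp]: "word_degree (map (iterate m) w) = word_degree w"
  by (simp add: word_degree_def comp_def degree_iterate)

lemma iterate_generators: "y \<in> generators E \<Longrightarrow> iterate m y \<in> generators E"
proof -
  assume y: "y \<in> generators E"
  have "(g ^^ n) y \<in> generators E" for n
    by (induction n) (simp_all add: y g_generators)
  then show ?thesis
    by (simp add: iterate_def)
qed

lemma map_iterate_iterate: "map (iterate m) (map (iterate n) w) = map (iterate (m + n)) w"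
  by (simp add: iterate_add)

lemma shift_add: "shift m (x + y) = shift m x + shift m y"
  by (simp add: shift_def relabel_add)

lemmas shift_diff = additive_diff[of "shift m" for m, OF shift_add]

lemma shift_single [simp]: "shift m (Poly_Mapping.single w a) = Poly_Mapping.single (map (iterate m) w) a"
  by (simp add: shift_def)

lemma shift_zero [simp]: "shift m 0 = 0"
  by (simp add: shift_def)

lemma shift_0 [simp]: "shift 0 x = x"
  by (simp add: shift_def relabel_id)

lemma shift_shift: "shift m (shift n x) = shift (m + n) x"
  by (simp add: shift_def relabel_relabel iterate_add)

lemma shift_in_F: "x \<in> F \<Longrightarrow> shift m x \<in> F"
proof (induction rule: free_carrier_induct)
  case (single w a)
  then show ?case
    by (auto intro!: single_in_free_carrier iterate_generators)
qed (simp_all add: zero_in_free_carrier shift_add add_in_free_carrier)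

lemma relabel_g_in_F: "x \<in> F \<Longrightarrow> relabel g x \<in> F"
  using shift_in_F[of x 1] by (simp add: shift_def iterate_1)

lemma relabel_g_in_I: "x \<in> I \<Longrightarrow> relabel g x \<in> I"
proof (induction rule: leavitt_ideal.induct)
  case (relation r)
  then show ?case by (rule g_relations)
next
  case (scale x c)
  then show ?case
    using leavitt_ideal.scale[OF scale.IH, of c] by (simp add: scale_eq_mult relabel_mult)
qed (auto simp: relabel_add relabel_mult intro: leavitt_ideal.intros relabel_g_in_F)

lemma shift_in_I: "x \<in> I \<Longrightarrow> shift m x \<in> I"
proof -
  assume x: "x \<in> I"
  have "relabel (g ^^ n) x \<in> I" for n
  proof (induction n)
    case 0
    then show ?case using x by (simp add: relabel_id flip: id_def)
  next
    case (Suc n)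
    then show ?case
      using relabel_g_in_I[OF Suc] by (simp add: relabel_relabel comp_def)
  qed
  then show ?thesis
    by (simp add: shift_def iterate_def)
qed

lemma shift_unit: "shift m u = u"
proof -
  have "relabel (g ^^ n) u = u" for n
  proof (induction n)
    case 0
    then show ?case by (simp add: relabel_id flip: id_def)
  next
    case (Suc n)
    then show ?case
      using g_local_unit relabel_relabel[of g "g ^^ n" u] by (simp add: comp_def)
  qed
  then show ?thesis
    by (simp add: shift_def iterate_def)
qed

lemma unit_in_F: "u \<in> F"
  unfolding local_unit_def
  by (intro sum_in_free_carrier gen_in_free_carrier) (simp add: generators_def)

text \<open>
  This product presents the Zhang twist by the \<open>c\<close>-th power of the automorphism; for \<open>c = 0\<close> it is the
  product of the free algebra.
\<close>

definition twisted_mult :: "int \<Rightarrow> ('v, 'e, 'k) path_poly \<Rightarrow> ('v, 'e, 'k) path_poly \<Rightarrow> ('v, 'e, 'k) path_poly" where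
  "twisted_mult c x y =
     linear_extension (\<lambda>w a. Poly_Mapping.single w a * shift (c * word_degree w) y) x"

lemma twisted_mult_add_left: "twisted_mult c (x + y) z = twisted_mult c x z + twisted_mult c y z"
  unfolding twisted_mult_def by (rule linear_extension_add) (simp_all add: single_add distrib_right)

lemma twisted_mult_add_right: "twisted_mult c x (y + z) = twisted_mult c x y + twisted_mult c x z"
  by (simp add: twisted_mult_def linear_extension_def shift_add distrib_left sum.distrib)

lemma twisted_mult_zero [simp]: "twisted_mult c 0 y = 0" "twisted_mult c x 0 = 0"
  by (simp_all add: twisted_mult_def linear_extension_def)

lemma twisted_mult_single_left:
  "twisted_mult c (Poly_Mapping.single w a) y = Poly_Mapping.single w a * shift (c * word_degree w) y"
  unfolding twisted_mult_def by (rule linear_extension_single) simp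

lemma twisted_mult_single:
  "twisted_mult c (Poly_Mapping.single w a) (Poly_Mapping.single v b) =
     Poly_Mapping.single (w @ map (iterate (c * word_degree w)) v) (a * b)"
  by (simp add: twisted_mult_single_left mult_single plus_list_def)

lemma twisted_mult_0: "twisted_mult 0 x y = x * y"
  by (induction x rule: single_induct)
    (simp_all add: twisted_mult_single_left twisted_mult_add_left distrib_right)

text \<open>
  On words \<open>w\<close>, \<open>v\<close>, \<open>z\<close> of which the first two have degrees $p$ and $q$, both sides are the
  concatenation of $w$, $\sigma^{cp}(v)$ and $\sigma^{c(p+q)}(z)$.
\<close>

lemma twisted_mult_assoc:
  "twisted_mult c (twisted_mult c x y) z = twisted_mult c x (twisted_mult c y z)"
proof (induction x rule: single_induct)
  case (single w a)
  show ?case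
  proof (induction y rule: single_induct)
    case (single v b)
    show ?case
      by (induction z rule: single_induct)
        (simp_all add: twisted_mult_single twisted_mult_add_right map_iterate_iterate distrib_left
          mult.assoc del: map_map)
  qed (simp add: twisted_mult_add_left twisted_mult_add_right)
qed (simp add: twisted_mult_add_left)

lemma twisted_mult_eq_sum_parts:
  "twisted_mult c x y = (\<Sum>m\<in>word_degree ` Poly_Mapping.keys x. part {m} x * shift (c * m) y)"
proof -
  have "twisted_mult c x y = (\<Sum>m\<in>word_degree ` Poly_Mapping.keys x.
      \<Sum>w\<in>{w \<in> Poly_Mapping.keys x. word_degree w = m}.
        Poly_Mapping.single w (Poly_Mapping.lookup x w) * shift (c * word_degree w) y)"
    unfolding twisted_mult_def linear_extension_def by (rule sum.image_gen) simp
  also have "\<dots> = (\<Sum>m\<in>word_degree ` Poly_Mapping.keys x. part {m} x * shift (c * m) y)"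
    unfolding part_eq_sum sum_distrib_right by (intro sum.cong) auto
  finally show ?thesis .
qed

lemma twisted_mult_in_F: "\<lbrakk>x \<in> F; y \<in> F\<rbrakk> \<Longrightarrow> twisted_mult c x y \<in> F"
  unfolding twisted_mult_eq_sum_parts
  by (intro sum_in_free_carrier mult_in_free_carrier part_in_free_carrier shift_in_F)

lemma twisted_mult_in_I_left: "\<lbrakk>x \<in> I; a \<in> F\<rbrakk> \<Longrightarrow> twisted_mult c a x \<in> I"
  unfolding twisted_mult_eq_sum_parts
  by (intro sum_in_leavitt_ideal leavitt_ideal.mult_left part_in_free_carrier shift_in_I)

lemma twisted_mult_in_I_right: "\<lbrakk>x \<in> I; a \<in> F\<rbrakk> \<Longrightarrow> twisted_mult c x a \<in> I"
  unfolding twisted_mult_eq_sum_parts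
  by (intro sum_in_leavitt_ideal leavitt_ideal.mult_right part_in_leavitt_ideal shift_in_F)

lemma twisted_mult_unit_left: "twisted_mult c u x = u * x"
proof -
  have "twisted_mult c u x = (\<Sum>v\<in>verts E. twisted_mult c (gen (Vertex v)) x)"
    unfolding local_unit_def by (rule additive_sum) (rule twisted_mult_add_left)
  also have "\<dots> = u * x"
    by (simp add: local_unit_def sum_distrib_right gen_def twisted_mult_single_left word_degree_def)
  finally show ?thesis .
qed

lemma twisted_mult_unit_right: "twisted_mult c x u = x * u"
  by (induction x rule: single_induct)
    (simp_all add: twisted_mult_single_left twisted_mult_add_left distrib_right shift_unit)

lemma presentationI:
  assumes "carrier Q = coset I ` F" "\<one>\<^bsub>Q\<^esub> = coset I u" "\<zero>\<^bsub>Q\<^esub> = coset I 0"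
    and "\<And>x y. \<lbrakk>x \<in> F; y \<in> F\<rbrakk> \<Longrightarrow> coset I x \<oplus>\<^bsub>Q\<^esub> coset I y = coset I (x + y)"
    and "\<And>x y. \<lbrakk>x \<in> F; y \<in> F\<rbrakk> \<Longrightarrow>
      coset I x \<otimes>\<^bsub>Q\<^esub> coset I y = coset I (twisted_mult c x y)"
  shows "ring_presentation F I (twisted_mult c) u Q"
  using assms leavitt_ideal_in_free_carrier
  by (intro ring_presentation.intro)
    (simp_all add: leavitt_ideal.zero diff_in_leavitt_ideal diff_in_free_carrier twisted_mult_in_F
      unit_in_F twisted_mult_add_left twisted_mult_add_right twisted_mult_assoc
      twisted_mult_in_I_left twisted_mult_in_I_right twisted_mult_unit_left twisted_mult_unit_right
      local_unit_mult mult_local_unit)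

text \<open>
  This is the entry at \<open>(i, j)\<close> of the block matrix that represents \<open>x\<close>.  A homogeneous element of
  degree $m$ contributes the product of the diagonal matrix of its images under $\sigma^{d i}$ with
  the $m$-th power of the cyclic shift, whose entry at \<open>(i, j)\<close> is nonzero iff $m \equiv j - i$ modulo \<open>N\<close>.
\<close>

definition block :: "int \<Rightarrow> nat \<Rightarrow> nat \<Rightarrow> ('v, 'e, 'k) path_poly \<Rightarrow> ('v, 'e, 'k) path_poly" where
  "block d i j x = shift (d * int i) (part {m. m mod int N = (int j - int i) mod int N} x)"

lemma block_add: "block d i j (x + y) = block d i j x + block d i j y"
  by (simp add: block_def part_add shift_add)

lemma block_single:
  "block d i j (Poly_Mapping.single w a) =
     (if word_degree w mod int N = (int j - int i) mod int N
      then Poly_Mapping.single (map (iterate (d * int i)) w) a else 0)"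
  by (simp add: block_def part_single)

lemma block_in_F: "x \<in> F \<Longrightarrow> block d i j x \<in> F"
  by (simp add: block_def shift_in_F part_in_free_carrier)

lemma block_in_I: "x \<in> I \<Longrightarrow> block d i j x \<in> I"
  by (simp add: block_def shift_in_I part_in_leavitt_ideal)

lemma block_unit:
  assumes "i < N" "j < N"
  shows "block d i j u = (if i = j then u else 0)"
proof -
  have "0 mod int N = (int j - int i) mod int N \<longleftrightarrow> int j mod int N = int i mod int N"
    by (auto simp: mod_eq_dvd_iff dvd_eq_mod_eq_0)
  also have "\<dots> \<longleftrightarrow> i = j"
    using assms by auto
  finally have "0 mod int N = (int j - int i) mod int N \<longleftrightarrow> i = j" .
  moreover have "part D u = (if 0 \<in> D then u else 0)" for D
    by (simp add: local_unit_def part_sum part_gen)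
  ultimately show ?thesis
    by (simp add: block_def shift_unit)
qed

text \<open>
  Both sides are biadditive, so it is enough to multiply two words, of degrees $p$ and $q$.
  The only contributing index \<open>j\<close> is the one with $j \equiv i + p$.  For it the second condition
  $q \equiv k - j$ becomes $p + q \equiv k - i$, and the second word is moved by
  $c'p + (c - c')j \equiv (c - c')i + cp$ on both sides.
\<close>

lemma block_mult:
  assumes i: "i < N" and k: "k < N"
  shows "block (c - c') i k (twisted_mult c x y) =
    (\<Sum>j<N. twisted_mult c' (block (c - c') i j x) (block (c - c') j k y))"
proof (induction x rule: single_induct)
  case (single w a)
  show ?case
  proof (induction y rule: single_induct)
    case (single v b)
    let ?p = "word_degree w" and ?q = "word_degree v" and ?d = "c - c'"
    define s where "s = nat ((int i + ?p) mod int N)"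
    have s: "s < N" "int s = (int i + ?p) mod int N"
      using N_pos by (simp_all add: s_def nat_less_iff)
    have s_iff: "?p mod int N = (int j - int i) mod int N \<longleftrightarrow> j = s" if "j < N" for j
    proof -
      have "?p mod int N = (int j - int i) mod int N \<longleftrightarrow> int N dvd (?p - (int j - int i))"
        by (rule mod_eq_dvd_iff)
      also have "\<dots> \<longleftrightarrow> (int i + ?p) mod int N = int j mod int N"
        by (simp add: mod_eq_dvd_iff algebra_simps)
      also have "\<dots> \<longleftrightarrow> j = s"
        using that by (auto simp flip: s(2))
      finally show ?thesis .
    qed
    have s_cong: "int N dvd (int s - (int i + ?p))"
      unfolding s(2) by (simp add: mod_eq_dvd_iff[symmetric])
    have "?q mod int N = (int k - int s) mod int N \<longleftrightarrow> int N dvd (?q - (int k - int s))"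
      by (rule mod_eq_dvd_iff)
    also have "\<dots> \<longleftrightarrow> int N dvd ((?p + ?q - (int k - int i)) + (int s - (int i + ?p)))"
      by (simp add: algebra_simps)
    also have "\<dots> \<longleftrightarrow> int N dvd (?p + ?q - (int k - int i))"
      by (rule dvd_add_left_iff[OF s_cong])
    also have "\<dots> \<longleftrightarrow> (?p + ?q) mod int N = (int k - int i) mod int N"
      by (rule mod_eq_dvd_iff[symmetric])
    finally have q_iff: "?q mod int N = (int k - int s) mod int N \<longleftrightarrow>
        (?p + ?q) mod int N = (int k - int i) mod int N" .
    have "(c' * ?p + ?d * int s) - (?d * int i + c * ?p) = ?d * (int s - (int i + ?p))"
      by (simp add: algebra_simps)
    then have it: "iterate (c' * ?p + ?d * int s) = iterate (?d * int i + c * ?p)"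
      using s_cong by (intro iterate_cong) (simp add: mod_eq_dvd_iff)
    have "(\<Sum>j<N. twisted_mult c' (block ?d i j (Poly_Mapping.single w a)) (block ?d j k (Poly_Mapping.single v b)))
        = (\<Sum>j<N. if j = s then twisted_mult c' (Poly_Mapping.single (map (iterate (?d * int i)) w) a)
             (block ?d s k (Poly_Mapping.single v b)) else 0)"
      using s_iff by (intro sum.cong) (auto simp: block_single[of _ i])
    also have "\<dots> = twisted_mult c' (Poly_Mapping.single (map (iterate (?d * int i)) w) a)
             (block ?d s k (Poly_Mapping.single v b))"
      using s by simp
    also have "\<dots> = block ?d i k (twisted_mult c (Poly_Mapping.single w a) (Poly_Mapping.single v b))"
      by (simp add: block_single q_iff twisted_mult_single map_iterate_iterate it del: map_map)
    finally show ?case ..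
  qed (simp add: twisted_mult_add_right block_add sum.distrib)
qed (simp add: twisted_mult_add_left block_add sum.distrib)

text \<open>
  The case \<open>c = 0\<close>, \<open>c' = 1\<close> and its reverse relate the algebra and its Zhang twist.
\<close>

theorem unbounded_generating_number_twist:
  assumes "ring_presentation F I (twisted_mult c) u Q" "ring_presentation F I (twisted_mult c') u Q'"
    and "unbounded_generating_number Q'"
  shows "unbounded_generating_number Q"
proof (rule unbounded_generating_number_along_matrix_hom[OF assms(1,2) N_pos _ _ _ _ _ assms(3)])
  show "block (c - c') i j (x + y) = block (c - c') i j x + block (c - c') i j y" for i j x y
    by (rule block_add)
  show "block (c - c') i j x \<in> F" if "x \<in> F" for i j x
    using that by (rule block_in_F)
  show "block (c - c') i j x \<in> I" if "x \<in> I" for i j x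
    using that by (rule block_in_I)
  show "block (c - c') i k (twisted_mult c x y) =
      (\<Sum>j<N. twisted_mult c' (block (c - c') i j x) (block (c - c') j k y))" if "i < N" "k < N" for i k x y
    using that by (rule block_mult)
  show "block (c - c') i j u = (if i = j then u else 0)" if "i < N" "j < N" for i j
    using that by (rule block_unit)
qed


section \<open>Presentations of the Leavitt path algebra and of its Zhang twist\<close>

lemma a_r_coset_eq: "I +>\<^bsub>free_path_algebra K E\<^esub> x = coset I x"
proof -
  have "y \<in> I +>\<^bsub>free_path_algebra K E\<^esub> x \<longleftrightarrow> y - x \<in> I" for y
    by (auto simp: a_r_coset_def r_coset_def free_path_algebra_def intro: bexI[of _ "y - x"])
  then show ?thesis
    by (auto simp: coset_def)
qed

lemmas coset_eq_iff = coset_eq_iff[of I, OF leavitt_ideal.zero diff_in_leavitt_ideal]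

lemma in_coset_imp_in_F: "\<lbrakk>x \<in> F; y \<in> coset I x\<rbrakk> \<Longrightarrow> y \<in> F"
  using leavitt_ideal_in_free_carrier add_in_free_carrier[of "y - x" E x]
  by (auto simp: coset_def)

lemma self_in_coset: "x \<in> coset I x"
  by (simp add: coset_def leavitt_ideal.zero)

lemma leavitt_path_algebra_presentation:
  "ring_presentation F I (twisted_mult 0) u (leavitt_path_algebra K E)"
proof (rule presentationI)
  let ?L = "leavitt_path_algebra K E"
  show "carrier ?L = coset I ` F"
  proof -
    have "carrier ?L = (\<Union>x\<in>F. {I +>\<^bsub>free_path_algebra K E\<^esub> x})"
      by (simp add: leavitt_path_algebra_def FactRing_def A_RCOSETS_def RCOSETS_def a_r_coset_def free_path_algebra_def)
    then show ?thesis
      by (auto simp: a_r_coset_eq)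
  qed
  have "\<one>\<^bsub>?L\<^esub> = I +>\<^bsub>free_path_algebra K E\<^esub> u"
    by (simp add: leavitt_path_algebra_def FactRing_def local_unit_def free_path_algebra_def)
  then show "\<one>\<^bsub>?L\<^esub> = coset I u"
    by (simp add: a_r_coset_eq)
  show "\<zero>\<^bsub>?L\<^esub> = coset I 0"
    by (simp add: leavitt_path_algebra_def FactRing_def coset_def)
  show "coset I x \<oplus>\<^bsub>?L\<^esub> coset I y = coset I (x + y)" for x y
  proof -
    have "coset I x \<oplus>\<^bsub>?L\<^esub> coset I y = (\<Union>a\<in>coset I x. \<Union>b\<in>coset I y. {a + b})"
      by (simp add: leavitt_path_algebra_def FactRing_def set_add_def set_mult_def free_path_algebra_def)
    also have "\<dots> = coset I (x + y)"
    proof (intro equalityI subsetI)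
      fix z assume "z \<in> (\<Union>a\<in>coset I x. \<Union>b\<in>coset I y. {a + b})"
      then obtain a b where "a - x \<in> I" "b - y \<in> I" "z = a + b"
        by (auto simp: coset_def)
      then show "z \<in> coset I (x + y)"
        using leavitt_ideal.add[of "a - x" E "b - y"] by (simp add: coset_def algebra_simps)
    next
      fix z assume "z \<in> coset I (x + y)"
      then have "z - y \<in> coset I x"
        by (simp add: coset_def algebra_simps)
      then show "z \<in> (\<Union>a\<in>coset I x. \<Union>b\<in>coset I y. {a + b})"
        using self_in_coset[of y] by (intro UN_I[of "z - y"] UN_I[of y]) auto
    qed
    finally show ?thesis .
  qed
  show "coset I x \<otimes>\<^bsub>?L\<^esub> coset I y = coset I (twisted_mult 0 x y)" if x: "x \<in> F" and y: "y \<in> F" for x y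
  proof -
    have "coset I x \<otimes>\<^bsub>?L\<^esub> coset I y
        = (\<Union>a\<in>coset I x. \<Union>b\<in>coset I y. I +>\<^bsub>free_path_algebra K E\<^esub> (a * b))"
      by (simp add: leavitt_path_algebra_def FactRing_def rcoset_mult_def free_path_algebra_def)
    also have "\<dots> = (\<Union>a\<in>coset I x. \<Union>b\<in>coset I y. coset I (x * y))"
    proof (intro SUP_cong refl)
      fix a b assume a: "a \<in> coset I x" and b: "b \<in> coset I y"
      have "(a - x) * b + x * (b - y) \<in> I"
        using a b x in_coset_imp_in_F[OF y b]
        by (intro leavitt_ideal.add leavitt_ideal.mult_right[of "a - x"] leavitt_ideal.mult_left[of "b - y"])
          (auto simp: coset_def)
      then show "I +>\<^bsub>free_path_algebra K E\<^esub> (a * b) = coset I (x * y)"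
        by (simp add: a_r_coset_eq coset_eq_iff algebra_simps)
    qed
    also have "\<dots> = coset I (x * y)"
      using self_in_coset by auto
    finally show ?thesis
      by (simp add: twisted_mult_0)
  qed
qed

sublocale L: ring_presentation F I "twisted_mult 0" u "leavitt_path_algebra K E"
  by (rule leavitt_path_algebra_presentation)

lemma leavitt_grading_eq: "leavitt_grading K E m = coset I ` {x \<in> F. part {m} x = x}"
proof -
  have "(\<forall>w\<in>Poly_Mapping.keys x. word_degree w = m) \<longleftrightarrow> part {m} x = x" for x :: "('v, 'e, 'k) path_poly"
  proof
    show "part {m} x = x" if "\<forall>w\<in>Poly_Mapping.keys x. word_degree w = m"
      using that by (intro part_eq_self) simp
    show "\<forall>w\<in>Poly_Mapping.keys x. word_degree w = m" if "part {m} x = x"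
      using keys_part[of "{m}" x] unfolding that by blast
  qed
  then show ?thesis
    by (simp add: leavitt_grading_def a_r_coset_eq)
qed

text \<open>
  Uniqueness of the homogeneous parts, which the definite description in \<^const>\<open>homogeneous_parts\<close>
  requires, holds because the ideal is graded: from $x - \sum_m y_m \in I$ one may take
  the part of degree $k$.
\<close>

lemma homogeneous_parts_eq:
  assumes x: "x \<in> F"
  shows "homogeneous_parts (leavitt_path_algebra K E) (leavitt_grading K E) (coset I x)
    = (\<lambda>m. coset I (part {m} x))"
  unfolding homogeneous_parts_def
proof (rule the_equality)
  let ?L = "leavitt_path_algebra K E" and ?c = "\<lambda>m. coset I (part {m} x)"
  let ?S = "{m. ?c m \<noteq> \<zero>\<^bsub>?L\<^esub>}" and ?T = "word_degree ` Poly_Mapping.keys x"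
  have S: "?S = {m. part {m} x \<notin> I}"
    by (simp add: L.Q_zero coset_eq_iff)
  have T: "part {m} x = 0" if "m \<notin> ?T" for m
    using that by (rule part_outside)
  have ST: "?S \<subseteq> ?T"
    unfolding S using T leavitt_ideal.zero by fastforce
  have "x - (\<Sum>m\<in>?S. part {m} x) = (\<Sum>m\<in>?T - ?S. part {m} x)"
    using ST sum_parts[of x] by (simp add: sum_diff)
  also have "\<dots> \<in> I"
    unfolding S by (rule sum_in_leavitt_ideal) auto
  finally have "coset I x = (\<Oplus>\<^bsub>?L\<^esub>m\<in>?S. ?c m)"
    using x by (simp add: L.finsum_coset part_in_free_carrier coset_eq_iff)
  moreover have "finite ?S"
    using ST by (rule finite_subset) simp
  moreover have "?c m \<in> leavitt_grading K E m" for m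
    using x by (auto simp: leavitt_grading_eq part_part part_in_free_carrier)
  ultimately show "(\<forall>m. ?c m \<in> leavitt_grading K E m) \<and> finite ?S \<and> coset I x = (\<Oplus>\<^bsub>?L\<^esub>m\<in>?S. ?c m)"
    by blast
next
  let ?L = "leavitt_path_algebra K E"
  fix c assume c: "(\<forall>m. c m \<in> leavitt_grading K E m) \<and> finite {m. c m \<noteq> \<zero>\<^bsub>?L\<^esub>} \<and>
    coset I x = (\<Oplus>\<^bsub>?L\<^esub>m\<in>{m. c m \<noteq> \<zero>\<^bsub>?L\<^esub>}. c m)"
  let ?S = "{m. c m \<noteq> \<zero>\<^bsub>?L\<^esub>}"
  have "\<forall>m. \<exists>y. y \<in> F \<and> part {m} y = y \<and> c m = coset I y"
    using c by (auto simp: leavitt_grading_eq)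
  then obtain y where y: "\<And>m. y m \<in> F" "\<And>m. part {m} (y m) = y m" "\<And>m. c m = coset I (y m)"
    by metis
  have "coset I x = (\<Oplus>\<^bsub>?L\<^esub>m\<in>?S. coset I (y m))"
    using c unfolding y(3) by blast
  then have sum: "x - (\<Sum>m\<in>?S. y m) \<in> I"
    using y(1) by (simp add: L.finsum_coset coset_eq_iff)
  have "y k - part {k} x \<in> I" for k
  proof -
    have "part {k} (y m) = (if m = k then y k else 0)" for m
      using y(2)[of m] part_part[of "{k}" "{m}" "y m"] y(2)[of k]
      by (auto simp: part_empty)
    then have "part {k} (\<Sum>m\<in>?S. y m) = (if k \<in> ?S then y k else 0)"
      using c by (simp add: part_sum)
    moreover have "y k \<in> I" if "k \<notin> ?S"
      using that y(3)[of k] by (simp add: L.Q_zero coset_eq_iff)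
    ultimately have "y k - part {k} (\<Sum>m\<in>?S. y m) \<in> I"
      by (auto simp: leavitt_ideal.zero)
    from diff_in_leavitt_ideal[OF this part_in_leavitt_ideal[OF sum, of "{k}"]] show ?thesis
      by (simp add: part_diff)
  qed
  then show "c = (\<lambda>m. coset I (part {m} x))"
    by (simp add: fun_eq_iff y(3) coset_eq_iff)
qed

context
  fixes \<sigma> :: "('v \<Rightarrow> 'v) \<times> ('e \<Rightarrow> 'e)"
  assumes g_eq: "\<And>y. y \<in> generators E \<Longrightarrow> g y = gen_map \<sigma> y"
begin

lemma leavitt_automorphism_coset:
  assumes x: "x \<in> F"
  shows "leavitt_automorphism K \<sigma> (coset I x) = coset I (shift 1 x)"
proof -
  have "free_map \<sigma> y = shift 1 y" if y: "y \<in> F" for y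
    unfolding free_map_eq_relabel shift_def iterate_1
  proof (rule relabel_cong)
    fix w z assume "w \<in> Poly_Mapping.keys y" "z \<in> set w"
    with y have "z \<in> generators E"
      unfolding free_carrier_def by blast
    then show "gen_map \<sigma> z = g z"
      by (rule g_eq[symmetric])
  qed
  then have "leavitt_automorphism K \<sigma> (coset I x) = shift 1 ` coset I x"
    unfolding leavitt_automorphism_def using in_coset_imp_in_F[OF x] by (intro image_cong) auto
  also have "\<dots> = coset I (shift 1 x)"
  proof (intro equalityI subsetI)
    fix z assume "z \<in> shift 1 ` coset I x"
    then show "z \<in> coset I (shift 1 x)"
      using shift_in_I by (auto simp: coset_def simp flip: shift_diff)
  next
    fix z assume "z \<in> coset I (shift 1 x)"
    then have "shift (-1) (z - shift 1 x) \<in> I"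
      by (intro shift_in_I) (simp add: coset_def)
    then have "shift (-1) z \<in> coset I x"
      by (simp add: shift_diff shift_shift coset_def)
    moreover have "z = shift 1 (shift (-1) z)"
      by (simp add: shift_shift)
    ultimately show "z \<in> shift 1 ` coset I x"
      by blast
  qed
  finally show ?thesis .
qed

text \<open>
  For negative exponents the definition iterates \<^const>\<open>inv_into\<close>, so injectivity on the carrier is needed
  to identify it with \<^term>\<open>shift (-1)\<close>.
\<close>

lemma automorphism_power_coset:
  assumes x: "x \<in> F"
  shows "automorphism_power (leavitt_path_algebra K E) (leavitt_automorphism K \<sigma>) m (coset I x)
    = coset I (shift m x)"
proof -
  let ?L = "leavitt_path_algebra K E" and ?\<sigma> = "leavitt_automorphism K \<sigma>"
  have pos: "(?\<sigma> ^^ n) (coset I x) = coset I (shift (int n) x)" for n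
    by (induction n) (simp_all add: leavitt_automorphism_coset shift_in_F[OF x] shift_shift add.commute)
  have "inj_on ?\<sigma> (carrier ?L)"
  proof (rule inj_onI)
    fix X Y assume "X \<in> carrier ?L" "Y \<in> carrier ?L" and eq: "?\<sigma> X = ?\<sigma> Y"
    then obtain y z where yz: "y \<in> F" "z \<in> F" "X = coset I y" "Y = coset I z"
      by (auto simp: L.Q_carrier)
    with eq have "shift (-1) (shift 1 y - shift 1 z) \<in> I"
      by (intro shift_in_I) (simp add: leavitt_automorphism_coset coset_eq_iff)
    with yz show "X = Y"
      by (simp add: shift_diff shift_shift coset_eq_iff)
  qed
  then have inv: "inv_into (carrier ?L) ?\<sigma> (coset I y) = coset I (shift (-1) y)" if "y \<in> F" for y
    using that by (intro inv_into_f_eq)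
      (simp_all add: L.coset_in_carrier shift_in_F leavitt_automorphism_coset shift_shift)
  have neg: "(inv_into (carrier ?L) ?\<sigma> ^^ n) (coset I x) = coset I (shift (- int n) x)" for n
    by (induction n) (simp_all add: inv shift_in_F[OF x] shift_shift)
  show ?thesis
    by (simp add: automorphism_power_def pos neg)
qed

text \<open>
  The defining sum of the twisted product runs over the degrees in which the part of \<open>x\<close> is nonzero
  modulo the ideal, whereas \<^const>\<open>twisted_mult\<close> runs over all degrees of words of \<open>x\<close>.  The additional summands
  lie in the ideal.
\<close>

lemma leavitt_zhang_twist_presentation:
  "ring_presentation F I (twisted_mult 1) u (leavitt_zhang_twist K E \<sigma>)"
proof (rule presentationI)
  let ?L = "leavitt_path_algebra K E"
  show "coset I x \<otimes>\<^bsub>leavitt_zhang_twist K E \<sigma>\<^esub> coset I y = coset I (twisted_mult 1 x y)"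
    if x: "x \<in> F" and y: "y \<in> F" for x y
  proof -
    let ?S = "{m. coset I (part {m} x) \<noteq> \<zero>\<^bsub>?L\<^esub>}" and ?T = "word_degree ` Poly_Mapping.keys x"
    have S: "?S = {m. part {m} x \<notin> I}"
      by (simp add: L.Q_zero coset_eq_iff)
    have T: "part {m} x = 0" if "m \<notin> ?T" for m
      using that by (rule part_outside)
    have ST: "?S \<subseteq> ?T"
      unfolding S using T leavitt_ideal.zero by fastforce
    have prod: "coset I (part {m} x) \<otimes>\<^bsub>?L\<^esub> coset I (shift m y) = coset I (part {m} x * shift m y)" for m
      using x y by (simp add: L.Q_mult part_in_free_carrier shift_in_F twisted_mult_0)
    have "coset I x \<otimes>\<^bsub>leavitt_zhang_twist K E \<sigma>\<^esub> coset I y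
        = (\<Oplus>\<^bsub>?L\<^esub>m\<in>?S. coset I (part {m} x * shift m y))"
      using x y by (simp add: leavitt_zhang_twist_def zhang_twist_def homogeneous_parts_eq
        automorphism_power_coset prod)
    also have "\<dots> = coset I (\<Sum>m\<in>?S. part {m} x * shift m y)"
      using x y by (intro L.finsum_coset mult_in_free_carrier part_in_free_carrier shift_in_F)
    also have "\<dots> = coset I (twisted_mult 1 x y)"
    proof -
      have "twisted_mult 1 x y - (\<Sum>m\<in>?S. part {m} x * shift m y)
          = (\<Sum>m\<in>?T - ?S. part {m} x * shift m y)"
        using ST by (simp add: twisted_mult_eq_sum_parts sum_diff)
      also have "\<dots> \<in> I"
        unfolding S using y
        by (intro sum_in_leavitt_ideal leavitt_ideal.mult_right shift_in_F) auto
      finally show ?thesis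
        by (simp add: coset_eq_iff[symmetric])
    qed
    finally show ?thesis .
  qed
next
  have fields: "carrier (leavitt_zhang_twist K E \<sigma>) = carrier (leavitt_path_algebra K E)"
    "one (leavitt_zhang_twist K E \<sigma>) = one (leavitt_path_algebra K E)"
    "zero (leavitt_zhang_twist K E \<sigma>) = zero (leavitt_path_algebra K E)"
    "add (leavitt_zhang_twist K E \<sigma>) = add (leavitt_path_algebra K E)"
    by (simp_all add: leavitt_zhang_twist_def zhang_twist_def)
  show "carrier (leavitt_zhang_twist K E \<sigma>) = coset I ` F"
    "\<one>\<^bsub>leavitt_zhang_twist K E \<sigma>\<^esub> = coset I u"
    "\<zero>\<^bsub>leavitt_zhang_twist K E \<sigma>\<^esub> = coset I 0"
    unfolding fields by (rule L.Q_carrier L.Q_one L.Q_zero)+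
  show "coset I x \<oplus>\<^bsub>leavitt_zhang_twist K E \<sigma>\<^esub> coset I y = coset I (x + y)"
    if "x \<in> F" "y \<in> F" for x y
    unfolding fields using that by (rule L.Q_add)
qed

lemma unbounded_generating_number_zhang_twist:
  "unbounded_generating_number (leavitt_path_algebra K E) \<longleftrightarrow>
   unbounded_generating_number (leavitt_zhang_twist K E \<sigma>)"
proof
  note presentations = leavitt_path_algebra_presentation leavitt_zhang_twist_presentation
  show "unbounded_generating_number (leavitt_zhang_twist K E \<sigma>)"
    if "unbounded_generating_number (leavitt_path_algebra K E)"
    by (rule unbounded_generating_number_twist[OF presentations(2,1) that])
  show "unbounded_generating_number (leavitt_path_algebra K E)"
    if "unbounded_generating_number (leavitt_zhang_twist K E \<sigma>)"
    by (rule unbounded_generating_number_twist[OF presentations that])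
qed

end

end


section \<open>Graph automorphisms are periodic\<close>

lemma gen_map_bij_generators:
  assumes "graph_automorphism E \<sigma>"
  shows "bij_betw (gen_map \<sigma>) (generators E) (generators E)"
proof (rule bij_betw_imageI)
  have inj: "inj_on (fst \<sigma>) (verts E)" "inj_on (snd \<sigma>) (arcs E)"
    and image: "fst \<sigma> ` verts E = verts E" "snd \<sigma> ` arcs E = arcs E"
    using assms by (simp_all add: graph_automorphism_def bij_betw_def)
  show "inj_on (gen_map \<sigma>) (generators E)"
  proof (rule inj_onI)
    fix x y assume "x \<in> generators E" "y \<in> generators E" "gen_map \<sigma> x = gen_map \<sigma> y"
    then show "x = y"
      by (cases x; cases y) (auto simp: generators_def dest: inj_onD[OF inj(1)] inj_onD[OF inj(2)])
  qed
  have "gen_map \<sigma> ` generators E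
      = Vertex ` fst \<sigma> ` verts E \<union> Edge ` snd \<sigma> ` arcs E \<union> Ghost ` snd \<sigma> ` arcs E"
    by (simp add: generators_def image_Un image_image)
  then show "gen_map \<sigma> ` generators E = generators E"
    by (simp only: generators_def image)
qed

lemma bij_betw_out_arcs:
  assumes "graph_automorphism E \<sigma>" "v \<in> verts E" "fin_digraph E"
  shows "bij_betw (snd \<sigma>) (out_arcs E v) (out_arcs E (fst \<sigma> v))"
proof (rule bij_betw_imageI)
  interpret fin_digraph E by fact
  have \<sigma>: "inj_on (fst \<sigma>) (verts E)" "inj_on (snd \<sigma>) (arcs E)" "snd \<sigma> ` arcs E = arcs E"
    "\<And>e. e \<in> arcs E \<Longrightarrow> tail E (snd \<sigma> e) = fst \<sigma> (tail E e)"
    using assms by (auto simp: graph_automorphism_def bij_betw_def)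
  show "inj_on (snd \<sigma>) (out_arcs E v)"
    using \<sigma>(2) by (rule inj_on_subset) auto
  show "snd \<sigma> ` out_arcs E v = out_arcs E (fst \<sigma> v)"
  proof (intro equalityI subsetI)
    fix e' assume e': "e' \<in> out_arcs E (fst \<sigma> v)"
    then obtain e where e: "e \<in> arcs E" "e' = snd \<sigma> e"
      using \<sigma>(3) by (metis imageE in_out_arcs_conv)
    then have "tail E e = v"
      using e' \<sigma> assms(2) by (auto dest: inj_onD)
    with e show "e' \<in> snd \<sigma> ` out_arcs E v"
      by auto
  qed (use \<sigma> in auto)
qed

theorem proposition4p9:
  fixes K :: "'k::field itself"
    and E :: "('v, 'e) pre_digraph"
    and \<sigma> :: "('v \<Rightarrow> 'v) \<times> ('e \<Rightarrow> 'e)"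
  assumes "fin_digraph E"
    and "graph_automorphism E \<sigma>"
  shows "unbounded_generating_number (leavitt_path_algebra K E) \<longleftrightarrow>
         unbounded_generating_number (leavitt_zhang_twist K E \<sigma>)"
proof -
  interpret fin_digraph E by fact
  \<comment> \<open>Off the generators $\sigma$ is arbitrary; extending it by the identity gives a permutation
    with finite support, which therefore has finite order.\<close>
  define g where "g y = (if y \<in> generators E then gen_map \<sigma> y else y)" for y
  have \<sigma>: "fst \<sigma> ` verts E = verts E" "inj_on (fst \<sigma>) (verts E)"
    "snd \<sigma> ` arcs E = arcs E" "inj_on (snd \<sigma>) (arcs E)"
    "\<And>e. e \<in> arcs E \<Longrightarrow> tail E (snd \<sigma> e) = fst \<sigma> (tail E e)"
    "\<And>e. e \<in> arcs E \<Longrightarrow> head E (snd \<sigma> e) = fst \<sigma> (head E e)"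
    using assms(2) by (auto simp: graph_automorphism_def bij_betw_def)
  have \<sigma>V: "fst \<sigma> v \<in> verts E" if "v \<in> verts E" for v
    using \<sigma>(1) that by blast
  have \<sigma>A: "snd \<sigma> e \<in> arcs E" if "e \<in> arcs E" for e
    using \<sigma>(3) that by blast
  have g: "\<And>v. v \<in> verts E \<Longrightarrow> g (Vertex v) = Vertex (fst \<sigma> v)"
    "\<And>e. e \<in> arcs E \<Longrightarrow> g (Edge e) = Edge (snd \<sigma> e)"
    "\<And>e. e \<in> arcs E \<Longrightarrow> g (Ghost e) = Ghost (snd \<sigma> e)"
    by (simp_all add: g_def generators_def)
  have bij: "bij_betw g (generators E) (generators E)"
    using gen_map_bij_generators[OF assms(2)] by (rule bij_betw_cong[THEN iffD1, rotated]) (simp add: g_def)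
  then have "g permutes generators E"
    by (rule bij_imp_permutes) (simp add: g_def)
  moreover have "finite (generators E)"
    by (simp add: generators_def)
  ultimately have "permutation g"
    unfolding permutation_permutes by blast
  then obtain N where N: "g ^^ N = id" "N > 0"
    using permutation_is_nilpotent by blast
  interpret periodic_relabelling E K g N
  proof unfold_locales
    show "g ^^ N = id" "N > 0" by (rule N)+
    show "gen_degree (g y) = gen_degree y" for y
      by (cases y) (simp_all add: g_def)
    show "g y \<in> generators E" if "y \<in> generators E" for y
      using bij that by (auto simp: bij_betw_def)
    show "relabel g (local_unit E) = (local_unit E :: ('v, 'e, 'k) path_poly)"
    proof -
      have "relabel g (local_unit E) = (\<Sum>v\<in>verts E. gen (Vertex (fst \<sigma> v)) :: ('v, 'e, 'k) path_poly)"
        by (simp add: local_unit_def relabel_sum relabel_gen g)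
      also have "\<dots> = local_unit E"
        unfolding local_unit_def using \<sigma>(1,2)
        by (intro sum.reindex_bij_betw[of "fst \<sigma>"]) (simp add: bij_betw_def)
      finally show ?thesis .
    qed
    show "relabel g r \<in> leavitt_ideal E" if "r \<in> leavitt_relations E" for r :: "('v, 'e, 'k) path_poly"
    proof (rule leavitt_ideal.relation)
      note relabel_simps = relabel_diff relabel_mult relabel_gen relabel_sum g
      from that show "relabel g r \<in> leavitt_relations E"
      proof cases
        case (vertices v w)
        then have "fst \<sigma> v = fst \<sigma> w \<longleftrightarrow> v = w"
          using \<sigma>(2) by (auto dest: inj_onD)
        then show ?thesis
          using vertices leavitt_relations.vertices[of "fst \<sigma> v" E "fst \<sigma> w"]
          by (auto simp: relabel_simps \<sigma>V)
      next
        case (edge_source e)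
        then show ?thesis
          using leavitt_relations.edge_source[of "snd \<sigma> e" E] by (simp add: relabel_simps \<sigma>A \<sigma>)
      next
        case (edge_range e)
        then show ?thesis
          using leavitt_relations.edge_range[of "snd \<sigma> e" E] by (simp add: relabel_simps \<sigma>A \<sigma>)
      next
        case (ghost_source e)
        then show ?thesis
          using leavitt_relations.ghost_source[of "snd \<sigma> e" E] by (simp add: relabel_simps \<sigma>A \<sigma>)
      next
        case (ghost_range e)
        then show ?thesis
          using leavitt_relations.ghost_range[of "snd \<sigma> e" E] by (simp add: relabel_simps \<sigma>A \<sigma>)
      next
        case (ghost_edge e f)
        then have "snd \<sigma> e = snd \<sigma> f \<longleftrightarrow> e = f"
          using \<sigma>(4) by (auto dest: inj_onD)
        then show ?thesis
          using ghost_edge leavitt_relations.ghost_edge[of "snd \<sigma> e" E "snd \<sigma> f"]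
          by (auto simp: relabel_simps \<sigma>A \<sigma>)
      next
        case (regular v)
        then have v: "v \<in> verts E"
          by (simp add: regular_vertex_def)
        note out = bij_betw_out_arcs[OF assms(2) v assms(1)]
        have "regular_vertex E (fst \<sigma> v)"
          using regular out \<sigma>V by (auto simp: regular_vertex_def bij_betw_def)
        moreover have "relabel g r = gen (Vertex (fst \<sigma> v))
            - (\<Sum>e\<in>out_arcs E v. gen (Edge (snd \<sigma> e)) * gen (Ghost (snd \<sigma> e)))"
          using regular v by (simp add: relabel_simps)
        moreover have "(\<Sum>e\<in>out_arcs E v. gen (Edge (snd \<sigma> e)) * gen (Ghost (snd \<sigma> e)))
            = (\<Sum>e\<in>out_arcs E (fst \<sigma> v). gen (Edge e) * gen (Ghost e) :: ('v, 'e, 'k) path_poly)"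
          by (rule sum.reindex_bij_betw[OF out])
        ultimately show ?thesis
          using leavitt_relations.regular[of E "fst \<sigma> v"] by simp
      qed
    qed
  qed
  show ?thesis
    by (rule unbounded_generating_number_zhang_twist) (simp add: g_def)
qed

end
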